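(* Let $\mathcal{A}$ be a free, irreducible central arrangement in $\mathbb{K}^3$ with exponents $\exp(\mathcal{A})=(1,a,b)$, $1\le a\le b$. Suppose that $\mathcal{A}\setminus\{H\}$ is not free for every $H\in\mathcal{A}$. Then $\mathcal{A}$ is $b$-critical, and $|\mathcal{A}|-|\mathcal{A}^H|\ne b$ for every $H\in\mathcal{A}$.
   Context: $S=\mathbb{K}[x_1,x_2,x_3]$, $\deg x_i=1$. For an arrangement $\mathcal{B}$, $\alpha_L$ is a fixed linear form with kernel $L$, $Q(\mathcal{B})=\prod_{L\in\mathcal{B}}\alpha_L$, $D(\mathcal{B})=\{\theta\in\bigoplus_iS\partial_{x_i}\mid\theta(\alpha_L)\in S\alpha_L\ \forall L\}$, $\Omega^1(\mathcal{B})=\{\omega\in\frac{1}{Q(\mathcal{B})}\bigoplus_iS\,dx_i\mid\omega\wedge d\alpha_L\in\frac{\alpha_L}{Q(\mathcal{B})}\Omega^2_V\ \forall L\}$, graded with $\deg\partial_{x_i}=\deg dx_i=0$. $\mathcal{B}$ is free with exponents $(d_1,\dots,d_\ell)$ if $D(\mathcal{B})\cong\bigoplus_iS[-d_i]$ (equivalently $\Omega^1(\mathcal{B})\cong\bigoplus_iS[d_i]$). Irreducible means $\mathcal{A}$ is not a product of two nonempty arrangements after a linear change of coordinates. $\mathcal{A}^H=\{H\cap L\mid L\in\mathcal{A}\setminus\{H\}\}$. $\mathcal{A}$ is $k$-critical if $\Omega^1(\mathcal{A})_{-k}\ne0$ and $\Omega^1(\mathcal{A}\setminus\{H\})_{-k}=0$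 for every $H\in\mathcal{A}$. *)

theory Defs
  imports
    "HOL-Analysis.Cartesian_Space"
    "HOL-Library.Poly_Mapping"
    "HOL-Computational_Algebra.Polynomial_Factorial"
begin

text \<open>
  The polynomial ring \<open>S = K[x\<^sub>1,x\<^sub>2,x\<^sub>3]\<close> is the convolution ring of finitely
  supported functions from exponent vectors to coefficients.
\<close>

type_synonym 'k S = "(3 \<Rightarrow>\<^sub>0 nat) \<Rightarrow>\<^sub>0 'k"

definition mdeg :: "(3 \<Rightarrow>\<^sub>0 nat) \<Rightarrow> nat" where
  "mdeg m = (\<Sum>i\<in>UNIV. Poly_Mapping.lookup m i)"

text \<open>Degrees are integers, so that \<open>homog d p\<close> forces \<open>p = 0\<close> for negative \<open>d\<close>; the
  zero polynomial is homogeneous of every degree.\<close>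

definition homog :: "int \<Rightarrow> 'k::field S \<Rightarrow> bool" where
  "homog d p \<longleftrightarrow> (\<forall>m\<in>Poly_Mapping.keys p. int (mdeg m) = d)"

definition partial :: "3 \<Rightarrow> 'k::field S \<Rightarrow> 'k S" where
  "partial i p = (\<Sum>m\<in>Poly_Mapping.keys p.
     Poly_Mapping.single (m - Poly_Mapping.single i 1)
       (of_nat (Poly_Mapping.lookup m i) * Poly_Mapping.lookup p m))"

definition linear_form :: "'k::field ^ 3 \<Rightarrow> 'k S" where
  "linear_form a = (\<Sum>i\<in>UNIV. Poly_Mapping.single (Poly_Mapping.single i 1) (a $ i))"

lemma partial_single:
  "partial i (Poly_Mapping.single m c) =
     Poly_Mapping.single (m - Poly_Mapping.single i 1) (of_nat (Poly_Mapping.lookup m i) * c)"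
  by (cases "c = 0") (simp_all add: partial_def)


section \<open>Arrangements\<close>

text \<open>Hyperplanes and arrangements are taken relative to an ambient subspace \<open>V\<close> of
  \<open>K\<^sup>3\<close>, since the factors of a product live in proper subspaces.\<close>

definition hyperplane_in :: "('k::field ^ 3) set \<Rightarrow> ('k ^ 3) set \<Rightarrow> bool" where
  "hyperplane_in V L \<longleftrightarrow> vec.subspace L \<and> L \<subseteq> V \<and> vec.dim L + 1 = vec.dim V"

definition arrangement_in :: "('k::field ^ 3) set \<Rightarrow> ('k ^ 3) set set \<Rightarrow> bool" where
  "arrangement_in V A \<longleftrightarrow> finite A \<and> (\<forall>L\<in>A. hyperplane_in V L)"

abbreviation central_arrangement :: "('k::field ^ 3) set set \<Rightarrow> bool" where
  "central_arrangement \<equiv> arrangement_in UNIV"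

definition subspace_sum :: "('k::field ^ 3) set \<Rightarrow> ('k ^ 3) set \<Rightarrow> ('k ^ 3) set" where
  "subspace_sum V W = {v + w | v w. v \<in> V \<and> w \<in> W}"

text \<open>The product of arrangements in \<open>V\<close> and \<open>W\<close> consists of all \<open>L \<oplus> W\<close> and
  \<open>V \<oplus> L\<close>. The linear change of coordinates is the choice of the internal direct sum
  decomposition \<open>K\<^sup>3 = V \<oplus> W\<close>.\<close>

definition reducible :: "('k::field ^ 3) set set \<Rightarrow> bool" where
  "reducible A \<longleftrightarrow> (\<exists>V W B C.
     vec.subspace V \<and> vec.subspace W \<and> V \<inter> W = {0} \<and> subspace_sum V W = UNIV \<and>
     arrangement_in V B \<and> B \<noteq> {} \<and> arrangement_in W C \<and> C \<noteq> {} \<and>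
     A = (\<lambda>L. subspace_sum L W) ` B \<union> (\<lambda>L. subspace_sum V L) ` C)"

definition restriction :: "('k::field ^ 3) set set \<Rightarrow> ('k ^ 3) set \<Rightarrow> ('k ^ 3) set set" where
  "restriction A H = (\<lambda>L. H \<inter> L) ` (A - {H})"

definition alpha :: "('k::field ^ 3) set \<Rightarrow> 'k S" where
  "alpha L = linear_form (SOME a. {v. (\<Sum>i\<in>UNIV. a $ i * v $ i) = 0} = L)"

definition defpoly :: "('k::field ^ 3) set set \<Rightarrow> 'k S" where
  "defpoly B = (\<Prod>L\<in>B. alpha L)"


section \<open>Logarithmic derivations\<close>

text \<open>The derivation \<open>\<Sum>\<^sub>i \<theta>\<^sub>i \<partial>\<^sub>i\<close> is encoded by its coefficient vector.\<close>

definition apply_der :: "'k::field S ^ 3 \<Rightarrow> 'k S \<Rightarrow> 'k S" where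
  "apply_der \<theta> f = (\<Sum>i\<in>UNIV. \<theta> $ i * partial i f)"

definition log_der :: "('k::field ^ 3) set set \<Rightarrow> ('k S ^ 3) set" where
  "log_der B = {\<theta>. \<forall>L\<in>B. alpha L dvd apply_der \<theta> (alpha L)}"

text \<open>\<open>D(B) \<cong> S[-d\<^sub>1] \<oplus> S[-d\<^sub>2] \<oplus> S[-d\<^sub>3]\<close> as graded modules: the degree \<open>k\<close> part of
  the right-hand side is the sum of the \<open>S\<^bsub>k - d\<^sub>i\<^esub>\<close>.\<close>

definition free_with_exponents :: "('k::field ^ 3) set set \<Rightarrow> nat ^ 3 \<Rightarrow> bool" where
  "free_with_exponents B d \<longleftrightarrow> (\<exists>\<Phi> :: 'k S ^ 3 \<Rightarrow> 'k S ^ 3.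
     module_hom (*s) (*s) \<Phi> \<and> bij_betw \<Phi> UNIV (log_der B) \<and>
     (\<forall>k f. (\<forall>i. homog (k - int (d $ i)) (f $ i)) \<longleftrightarrow> (\<forall>i. homog k (\<Phi> f $ i))))"

definition free_arrangement :: "('k::field ^ 3) set set \<Rightarrow> bool" where
  "free_arrangement B \<longleftrightarrow> (\<exists>d. free_with_exponents B d)"


section \<open>Logarithmic 1-forms\<close>

text \<open>Rational 1-forms \<open>\<Sum>\<^sub>i \<omega>\<^sub>i dx\<^sub>i\<close> are coefficient vectors over the fraction field of
  \<open>S\<close>. A 2-form \<open>\<Sum>\<^bsub>i<j\<^esub> \<eta>\<^sub>i\<^sub>j dx\<^sub>i \<and> dx\<^sub>j\<close> is encoded by its alternating coefficient matrix.\<close>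

definition wedge :: "'f::field ^ 3 \<Rightarrow> 'f ^ 3 \<Rightarrow> 'f ^ 3 ^ 3" where
  "wedge \<omega> \<eta> = (\<chi> i j. \<omega> $ i * \<eta> $ j - \<omega> $ j * \<eta> $ i)"

definition differential :: "'k::field S \<Rightarrow> 'k S fract ^ 3" where
  "differential f = (\<chi> i. to_fract (partial i f))"

definition regular_1forms :: "('k::field S fract ^ 3) set" where
  "regular_1forms = {\<chi> i. to_fract (s $ i) | s. True}"

definition regular_2forms :: "('k::field S fract ^ 3 ^ 3) set" where
  "regular_2forms = {\<chi> i j. to_fract (s $ i $ j) | s.
     (\<forall>i. s $ i $ i = 0) \<and> (\<forall>i j. s $ i $ j = - s $ j $ i)}"

definition log_1forms :: "('k::field ^ 3) set set \<Rightarrow> ('k S fract ^ 3) set" where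
  "log_1forms B = {\<omega>.
     (\<exists>\<eta>\<in>regular_1forms. \<omega> = (1 / to_fract (defpoly B)) *s \<eta>) \<and>
     (\<forall>L\<in>B. \<exists>\<eta>\<in>regular_2forms. wedge \<omega> (differential (alpha L)) =
        (\<chi> i j. to_fract (alpha L) / to_fract (defpoly B) * \<eta> $ i $ j))}"

definition fract_homog :: "int \<Rightarrow> 'k::field S fract \<Rightarrow> bool" where
  "fract_homog k q \<longleftrightarrow> (\<exists>f g e. g \<noteq> 0 \<and> homog (e + k) f \<and> homog e g \<and> q = Fract f g)"

definition log_1forms_deg :: "('k::field ^ 3) set set \<Rightarrow> int \<Rightarrow> ('k S fract ^ 3) set" where
  "log_1forms_deg B k = {\<omega>\<in>log_1forms B. \<forall>i. fract_homog k (\<omega> $ i)}"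

definition critical :: "int \<Rightarrow> ('k::field ^ 3) set set \<Rightarrow> bool" where
  "critical k A \<longleftrightarrow> log_1forms_deg A (- k) \<noteq> {0} \<and>
     (\<forall>H\<in>A. log_1forms_deg (A - {H}) (- k) = {0})"

end

theory Submission
  imports Defs "HOL-Analysis.Determinants"
begin

text \<open>
  Fix \<open>H\<close> and take a basis \<open>\<theta>\<^sub>E, \<theta>\<^sub>2, \<theta>\<^sub>3\<close> of \<open>D(\<A>)\<close> of degrees \<open>1, a, b\<close> that starts with the Euler
  derivation. If some \<open>\<theta>\<^sub>r\<close> with \<open>r \<noteq> 1\<close> is a multiple of \<open>\<theta>\<^sub>E\<close> on \<open>H\<close>, say
  \<open>\<theta>\<^sub>r = f \<theta>\<^sub>E + \<alpha>\<^sub>H \<phi>\<close>, then replacing \<open>\<theta>\<^sub>r\<close> by \<open>\<phi>\<close> gives a basis of \<open>D(\<A> - {H})\<close> by Saito's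
  criterion. Both claims produce such a basis of \<open>D(\<A>)\<close>.

  If \<open>|\<A>\<^sup>H| = a + 1\<close>, the determinants of \<open>\<theta>\<^sub>2\<close> and \<open>\<theta>\<^sub>3\<close> with \<open>\<theta>\<^sub>E\<close> on \<open>H\<close> are multiples of a polynomial
  of degree \<open>a + 1\<close>, so either the first vanishes or a multiple of \<open>\<theta>\<^sub>2\<close> can be subtracted from
  \<open>\<theta>\<^sub>3\<close> to make the second vanish. If \<open>\<omega> \<noteq> 0\<close> lies in \<open>\<Omega>\<^sup>1(\<A> - {H})\<close> in degree \<open>-b\<close> and \<open>b \<ge> 2\<close>, then
  \<open>\<langle>\<omega>, \<theta>\<^sub>E\<rangle> = 0\<close> by degree, so \<open>Q(\<A>) \<omega>\<close> is proportional to \<open>\<theta>\<^sub>E \<times> w\<close> for a combination \<open>w\<close> of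
  \<open>\<theta>\<^sub>2\<close> and \<open>\<theta>\<^sub>3\<close>; as \<open>\<omega>\<close> has no pole along \<open>H\<close>, \<open>w\<close> is a multiple of \<open>\<theta>\<^sub>E\<close> on \<open>H\<close>. The case
  \<open>b = 1\<close> reduces to \<open>|\<A>\<^sup>H| = 2\<close>.
\<close>


section \<open>Homogeneous polynomials and substitutions\<close>

definition pconst :: "'k::field \<Rightarrow> 'k S" where
  "pconst c = Poly_Mapping.single 0 c"

definition pvar :: "3 \<Rightarrow> 'k::field S" where
  "pvar i = Poly_Mapping.single (Poly_Mapping.single i 1) 1"

lemma pconst_0 [simp]: "pconst 0 = 0"
  and pconst_1 [simp]: "pconst 1 = 1"
  and pconst_eq_0_iff [simp]: "pconst c = 0 \<longleftrightarrow> c = 0"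
  by (simp_all add: pconst_def)
    (metis lookup_single_eq lookup_zero single_zero)

lemma pconst_add: "pconst (c + d) = pconst c + pconst d"
  and pconst_diff: "pconst (c - d) = pconst c - pconst d"
  and pconst_uminus: "pconst (- c) = - pconst c"
  and pconst_mult: "pconst (c * d) = pconst c * pconst d"
  by (simp_all add: pconst_def single_add single_diff single_uminus mult_single)

lemma pconst_mult_dvd_iff:
  assumes "c \<noteq> 0"
  shows "p dvd pconst c * q \<longleftrightarrow> p dvd q"
proof
  assume "p dvd pconst c * q"
  then have "p dvd pconst (1 / c) * (pconst c * q)"
    by (rule dvd_mult)
  then show "p dvd q"
    using assms by (simp flip: pconst_mult mult.assoc)
qed simp

lemma linear_form_altdef: "linear_form a = (\<Sum>i\<in>UNIV. pconst (a $ i) * pvar i)"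
  by (simp add: linear_form_def pconst_def pvar_def mult_single)

lemma monomial_sum: "p = (\<Sum>m\<in>Poly_Mapping.keys p. Poly_Mapping.single m (Poly_Mapping.lookup p m))"
  by (rule poly_mapping_eqI)
    (simp add: lookup_sum lookup_single when_def in_keys_iff)

lemma exponent_sum:
  fixes m :: "3 \<Rightarrow>\<^sub>0 nat"
  shows "(\<Sum>i\<in>UNIV. Poly_Mapping.single i (Poly_Mapping.lookup m i)) = m"
  by (rule poly_mapping_eqI) (simp add: lookup_sum lookup_single when_def)

lemma pvar_power: "pvar i ^ n = Poly_Mapping.single (Poly_Mapping.single i n) 1"
  by (induction n) (simp_all add: pvar_def mult_single single_add[symmetric])

lemma prod_single_1:
  "finite I \<Longrightarrow> (\<Prod>i\<in>I. Poly_Mapping.single (f i) (1::'k::field)) = Poly_Mapping.single (\<Sum>i\<in>I. f i) 1"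
  for f :: "'i \<Rightarrow> 3 \<Rightarrow>\<^sub>0 nat"
  by (induction I rule: finite_induct) (simp_all add: mult_single)

lemma single_eq_monomial:
  "Poly_Mapping.single m c = pconst c * (\<Prod>i\<in>UNIV. pvar i ^ Poly_Mapping.lookup m i)"
  by (simp add: pvar_power prod_single_1 exponent_sum pconst_def mult_single)

text \<open>Monomials are products of constants and variables, and polynomials are sums of
  monomials. The rule serves congruences that respect sums and products.\<close>

lemma S_induct [case_names const var add mult]:
  assumes const: "\<And>c. P (pconst c)" and var: "\<And>i. P (pvar i)"
    and add: "\<And>p q. P p \<Longrightarrow> P q \<Longrightarrow> P (p + q)"
    and mult: "\<And>p q. P p \<Longrightarrow> P q \<Longrightarrow> P (p * q)"
  shows "P p"
proof -
  have power: "P (pvar i ^ n)" for i n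
    by (induction n) (use const[of 1] var mult in auto)
  have "P (\<Prod>i\<in>I. pvar i ^ f i)" if "finite I" for I and f :: "3 \<Rightarrow> nat"
    using that by (induction I rule: finite_induct) (use const[of 1] power mult in auto)
  then have monomial: "P (Poly_Mapping.single m c)" for m c
    by (simp add: single_eq_monomial const mult)
  have "P (\<Sum>m\<in>M. Poly_Mapping.single m (f m))" if "finite M" for M f
    using that by (induction M rule: finite_induct) (use const[of 0] monomial add in auto)
  then show ?thesis
    by (subst monomial_sum) simp
qed

section \<open>Homogeneous polynomials\<close>

lemma mdeg_add: "mdeg (m + n) = mdeg m + mdeg n"
  by (simp add: mdeg_def lookup_add sum.distrib)

lemma homog_0 [simp]: "homog d 0"
  by (simp add: homog_def)

lemma homog_pconst [simp]: "homog 0 (pconst c)"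
  by (simp add: homog_def pconst_def mdeg_def)

lemma homog_1 [simp]: "homog 0 1"
  using homog_pconst[of 1] by simp

lemma homog_pvar [simp]: "homog 1 (pvar i)"
  by (simp add: homog_def pvar_def mdeg_def lookup_single when_def)

lemma homog_add: "homog d p \<Longrightarrow> homog d q \<Longrightarrow> homog d (p + q)"
  using keys_add[of p q] by (auto simp: homog_def)

lemma homog_uminus: "homog d p \<Longrightarrow> homog d (- p)"
  by (simp add: homog_def in_keys_iff)

lemma homog_diff: "homog d p \<Longrightarrow> homog d q \<Longrightarrow> homog d (p - q)"
  using homog_add[OF _ homog_uminus, of d p q] by simp

lemma homog_sum: "(\<And>i. i \<in> I \<Longrightarrow> homog d (f i)) \<Longrightarrow> homog d (\<Sum>i\<in>I. f i)"
  by (induction I rule: infinite_finite_induct) (auto intro: homog_add)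

lemma homog_mult: "homog d p \<Longrightarrow> homog e q \<Longrightarrow> homog (d + e) (p * q)"
  using keys_mult[of p q] by (fastforce simp: homog_def mdeg_add)

lemma homog_mult_eq: "homog d p \<Longrightarrow> homog e q \<Longrightarrow> d + e = n \<Longrightarrow> homog n (p * q)"
  using homog_mult by blast

lemma homog_prod:
  "(\<And>i. i \<in> I \<Longrightarrow> homog (d i) (f i)) \<Longrightarrow> homog (\<Sum>i\<in>I. d i) (\<Prod>i\<in>I. f i)"
  by (induction I rule: infinite_finite_induct) (auto intro: homog_mult)

lemma homog_power: "homog d p \<Longrightarrow> homog (int n * d) (p ^ n)"
  by (induction n) (auto intro: homog_mult_eq simp: algebra_simps)

lemma homog_linear_form [simp]: "homog 1 (linear_form a)"
  unfolding linear_form_altdef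
  by (intro homog_sum homog_mult_eq[where d = 0 and e = 1]) auto

lemma homog_neg: "homog d p \<Longrightarrow> d < 0 \<Longrightarrow> p = 0"
  by (metis homog_def int_ops(1) keys_eq_empty of_nat_0_le_iff not_le equals0I)

lemma homog_0_imp_pconst:
  assumes "homog 0 p"
  obtains c where "p = pconst c"
proof
  have "m = 0" if "m \<in> Poly_Mapping.keys p" for m
  proof (rule poly_mapping_eqI)
    have "mdeg m = 0" using assms that by (simp add: homog_def)
    then show "Poly_Mapping.lookup m i = Poly_Mapping.lookup 0 i" for i
      by (simp add: mdeg_def)
  qed
  then have "Poly_Mapping.lookup p m = 0" if "m \<noteq> 0" for m
    using that by (auto simp: in_keys_iff)
  then show "p = pconst (Poly_Mapping.lookup p 0)"
    by (intro poly_mapping_eqI) (simp add: pconst_def lookup_single when_def)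
qed

text \<open>Split the cofactor into its part of degree \<open>n - d\<close> and the rest: the rest contributes no
  monomial of degree \<open>n\<close> to the product, so it is annihilated.\<close>

lemma homog_mult_cancel:
  assumes p: "homog d p" "p \<noteq> 0" and pq: "homog n (p * q)"
  shows "homog (n - d) q"
proof -
  define M where "M = {m \<in> Poly_Mapping.keys q. int (mdeg m) = n - d}"
  define r where "r = (\<Sum>m\<in>M. Poly_Mapping.single m (Poly_Mapping.lookup q m))"
  have r: "homog (n - d) r"
    unfolding r_def by (intro homog_sum) (auto simp: M_def homog_def)
  have "finite M" by (simp add: M_def)
  then have rest: "int (mdeg m) \<noteq> n - d" if "m \<in> Poly_Mapping.keys (q - r)" for m
    using that
    by (auto simp: r_def M_def in_keys_iff lookup_minus lookup_sum lookup_single when_def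
        split: if_splits)
  have "homog (d + (n - d)) (p * r)"
    by (intro homog_mult p r)
  then have "homog n (p * (q - r))"
    using pq by (simp add: right_diff_distrib homog_diff)
  then have "Poly_Mapping.keys (p * (q - r)) = {}"
    using keys_mult[of p "q - r"] p(1) rest by (fastforce simp: homog_def mdeg_add)
  then have "q - r = 0"
    using p(2) by simp
  with r show ?thesis by simp
qed

text \<open>This is the evaluation homomorphism: the endomorphism of the \<open>K\<close>-algebra
  \<open>S\<close> that sends \<open>pvar i\<close> to \<open>s i\<close>.\<close>

definition psubst :: "(3 \<Rightarrow> 'k::field S) \<Rightarrow> 'k S \<Rightarrow> 'k S" where
  "psubst s p = (\<Sum>m\<in>Poly_Mapping.keys p. pconst (Poly_Mapping.lookup p m) *
     (\<Prod>i\<in>UNIV. s i ^ Poly_Mapping.lookup m i))"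

lemma psubst_superset:
  assumes "finite F" "Poly_Mapping.keys p \<subseteq> F"
  shows "psubst s p = (\<Sum>m\<in>F. pconst (Poly_Mapping.lookup p m) *
     (\<Prod>i\<in>UNIV. s i ^ Poly_Mapping.lookup m i))"
  unfolding psubst_def using assms
  by (intro sum.mono_neutral_left) (auto simp: in_keys_iff)

lemma psubst_add: "psubst s (p + q) = psubst s p + psubst s q"
proof -
  let ?F = "Poly_Mapping.keys p \<union> Poly_Mapping.keys q"
  have "Poly_Mapping.keys (p + q) \<subseteq> ?F" by (rule keys_add)
  then show ?thesis
    by (simp add: psubst_superset[of ?F] lookup_add pconst_add distrib_right sum.distrib)
qed

lemma psubst_single:
  "psubst s (Poly_Mapping.single m c) = pconst c * (\<Prod>i\<in>UNIV. s i ^ Poly_Mapping.lookup m i)"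
  by (subst psubst_superset[of "{m}"]) auto

lemma psubst_0 [simp]: "psubst s 0 = 0"
  by (simp add: psubst_def)

lemma psubst_sum: "psubst s (\<Sum>i\<in>I. f i) = (\<Sum>i\<in>I. psubst s (f i))"
  by (induction I rule: infinite_finite_induct) (simp_all add: psubst_add)

lemma psubst_pconst [simp]: "psubst s (pconst c) = pconst c"
  unfolding pconst_def[of c] by (simp add: psubst_single) (simp add: pconst_def)

lemma psubst_1 [simp]: "psubst s 1 = 1"
  using psubst_pconst[of s 1] by simp

lemma psubst_pvar [simp]: "psubst s (pvar i) = s i"
proof -
  have "(\<Prod>j\<in>UNIV. s j ^ Poly_Mapping.lookup (Poly_Mapping.single i 1) j) =
      (\<Prod>j\<in>UNIV. if j = i then s i else 1)"
    by (intro prod.cong) (auto simp: lookup_single when_def)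
  then show ?thesis
    by (simp add: pvar_def psubst_single)
qed

lemma psubst_mult: "psubst s (p * q) = psubst s p * psubst s q"
proof -
  \<comment> \<open>Both sides are additive in each factor, so monomials suffice; there the
    exponents add.\<close>
  have single: "psubst s (Poly_Mapping.single m c * Poly_Mapping.single n d) =
      psubst s (Poly_Mapping.single m c) * psubst s (Poly_Mapping.single n d)" for m n c d
    by (simp add: mult_single psubst_single lookup_add power_add prod.distrib pconst_mult
        algebra_simps)
  define P Q where "P = (\<lambda>m. Poly_Mapping.single m (Poly_Mapping.lookup p m))"
    and "Q = (\<lambda>m. Poly_Mapping.single m (Poly_Mapping.lookup q m))"
  have "p = (\<Sum>m\<in>Poly_Mapping.keys p. P m)" "q = (\<Sum>m\<in>Poly_Mapping.keys q. Q m)"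
    unfolding P_def Q_def by (rule monomial_sum)+
  moreover have "psubst s (sum P M * sum Q N) = psubst s (sum P M) * psubst s (sum Q N)" for M N
    by (simp add: sum_product psubst_sum) (simp add: P_def Q_def single)
  ultimately show ?thesis by metis
qed

lemma psubst_uminus: "psubst s (- p) = - psubst s p"
  using psubst_add[of s p "- p"] by (simp add: add_eq_0_iff2)

lemma psubst_diff: "psubst s (p - q) = psubst s p - psubst s q"
  using psubst_add[of s p "- q"] by (simp add: psubst_uminus)

lemma psubst_prod: "psubst s (\<Prod>i\<in>I. f i) = (\<Prod>i\<in>I. psubst s (f i))"
  by (induction I rule: infinite_finite_induct) (simp_all add: psubst_mult)

lemma homog_psubst:
  assumes "\<And>i. homog 1 (s i)" "homog d p"
  shows "homog d (psubst s p)"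
  unfolding psubst_def
proof (intro homog_sum homog_mult_eq[where d = 0 and e = d])
  fix m assume m: "m \<in> Poly_Mapping.keys p"
  have "homog (\<Sum>i\<in>UNIV. int (Poly_Mapping.lookup m i) * 1) (\<Prod>i\<in>UNIV. s i ^ Poly_Mapping.lookup m i)"
    by (intro homog_prod homog_power assms)
  moreover have "(\<Sum>i\<in>UNIV. int (Poly_Mapping.lookup m i) * 1) = d"
    using assms(2) m by (simp add: homog_def mdeg_def)
  ultimately show "homog d (\<Prod>i\<in>UNIV. s i ^ Poly_Mapping.lookup m i)" by simp
qed auto


section \<open>Linear forms\<close>

lemma linear_form_diff: "linear_form (a - b) = linear_form a - linear_form b"
  and linear_form_scale: "linear_form (c *s a) = pconst c * linear_form a"
  by (simp_all add: linear_form_altdef pconst_add pconst_diff pconst_mult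
      distrib_right left_diff_distrib sum.distrib sum_subtractf sum_distrib_left mult.assoc)

lemma lookup_linear_form: "Poly_Mapping.lookup (linear_form a) (Poly_Mapping.single i 1) = a $ i"
proof -
  have "(Poly_Mapping.single j 1 = Poly_Mapping.single i (1::nat)) \<longleftrightarrow> j = i" for j :: 3
    by (metis keys_single singleton_inject one_neq_zero)
  then show ?thesis
    by (simp add: linear_form_def lookup_sum lookup_single when_def)
qed

lemma linear_form_eq_iff: "linear_form a = linear_form b \<longleftrightarrow> a = b"
  by (metis lookup_linear_form vec_eq_iff)

lemma linear_form_eq_0_iff [simp]: "linear_form a = 0 \<longleftrightarrow> a = 0"
  using linear_form_eq_iff[of a 0] by (simp add: linear_form_altdef)

lemma psubst_linear_form: "psubst s (linear_form a) = (\<Sum>i\<in>UNIV. pconst (a $ i) * s i)"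
  by (simp add: linear_form_altdef psubst_sum psubst_mult)

section \<open>Partial derivatives of linear forms\<close>

lemma partial_superset:
  assumes "finite F" "Poly_Mapping.keys p \<subseteq> F"
  shows "partial i p = (\<Sum>m\<in>F. Poly_Mapping.single (m - Poly_Mapping.single i 1)
     (of_nat (Poly_Mapping.lookup m i) * Poly_Mapping.lookup p m))"
  unfolding partial_def using assms
  by (intro sum.mono_neutral_left) (auto simp: in_keys_iff)

lemma partial_add: "partial i (p + q) = partial i p + partial i q"
proof -
  let ?F = "Poly_Mapping.keys p \<union> Poly_Mapping.keys q"
  have "Poly_Mapping.keys (p + q) \<subseteq> ?F" by (rule keys_add)
  then show ?thesis
    by (simp add: partial_superset[of ?F] lookup_add distrib_left single_add sum.distrib)
qed

lemma partial_sum: "partial i (\<Sum>j\<in>J. f j) = (\<Sum>j\<in>J. partial i (f j))"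
  by (induction J rule: infinite_finite_induct) (simp_all add: partial_add, simp_all add: partial_def)

lemma partial_linear_form: "partial i (linear_form a) = pconst (a $ i)"
proof -
  have "partial i (linear_form a) =
      (\<Sum>j\<in>UNIV. if j = i then Poly_Mapping.single 0 (a $ i) else 0)"
    unfolding linear_form_def partial_sum
    by (intro sum.cong) (auto simp: partial_single lookup_single when_def)
  then show ?thesis by (simp add: pconst_def)
qed

lemma apply_der_linear_form: "apply_der \<theta> (linear_form a) = (\<Sum>i\<in>UNIV. \<theta> $ i * pconst (a $ i))"
  by (simp add: apply_der_def partial_linear_form)

text \<open>Reduction modulo \<open>linear_form a\<close>, realised as the substitution that eliminates the
  variable \<open>i\<close>; it is meaningful only if \<open>a $ i \<noteq> 0\<close>.\<close>

definition elim_var :: "'k::field ^ 3 \<Rightarrow> 3 \<Rightarrow> 'k S \<Rightarrow> 'k S" where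
  "elim_var a i = psubst (\<lambda>l. if l = i then pvar i - pconst (1 / a $ i) * linear_form a else pvar l)"

lemma elim_var_add: "elim_var a i (p + q) = elim_var a i p + elim_var a i q"
  and elim_var_diff: "elim_var a i (p - q) = elim_var a i p - elim_var a i q"
  and elim_var_mult: "elim_var a i (p * q) = elim_var a i p * elim_var a i q"
  and elim_var_prod: "elim_var a i (\<Prod>j\<in>J. f j) = (\<Prod>j\<in>J. elim_var a i (f j))"
  and elim_var_sum: "elim_var a i (\<Sum>j\<in>J. f j) = (\<Sum>j\<in>J. elim_var a i (f j))"
  and elim_var_1 [simp]: "elim_var a i 1 = 1"
  and elim_var_0 [simp]: "elim_var a i 0 = 0"
  and elim_var_pconst [simp]: "elim_var a i (pconst c) = pconst c"
  by (simp_all add: elim_var_def psubst_add psubst_diff psubst_mult psubst_prod psubst_sum)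

lemma elim_var_pvar: "j \<noteq> i \<Longrightarrow> elim_var a i (pvar j) = pvar j"
  by (simp add: elim_var_def)

lemma homog_elim_var:
  assumes "homog d p"
  shows "homog d (elim_var a i p)"
  unfolding elim_var_def using assms
  by (intro homog_psubst)
     (auto intro!: homog_diff homog_mult_eq[where d = 0 and e = 1])

lemma elim_var_linear_form:
  "elim_var a i (linear_form b) = linear_form (b - (b $ i / a $ i) *s a)"
proof -
  have "elim_var a i (linear_form b) =
      (\<Sum>j\<in>UNIV. pconst (b $ j) * pvar j - (if j = i then pconst (b $ i / a $ i) * linear_form a else 0))"
    unfolding elim_var_def psubst_linear_form
    by (intro sum.cong) (auto simp: algebra_simps simp flip: pconst_mult mult.assoc)
  then show ?thesis
    by (simp add: sum_subtractf linear_form_diff linear_form_scale flip: linear_form_altdef)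
qed

lemma elim_var_self: "a $ i \<noteq> 0 \<Longrightarrow> elim_var a i (linear_form a) = 0"
  by (simp add: elim_var_linear_form)

lemma linear_form_dvd_diff_elim_var: "linear_form a dvd p - elim_var a i p"
proof (induction p rule: S_induct)
  case (var j)
  then show ?case by (cases "j = i") (auto simp: elim_var_def)
next
  case (add p q)
  then have "linear_form a dvd (p - elim_var a i p) + (q - elim_var a i q)"
    by (rule dvd_add)
  then show ?case by (simp add: elim_var_add algebra_simps)
next
  case (mult p q)
  then have "linear_form a dvd (p - elim_var a i p) * q + elim_var a i p * (q - elim_var a i q)"
    by (intro dvd_add dvd_mult dvd_mult2)
  then show ?case by (simp add: elim_var_mult algebra_simps)
qed simp

text \<open>The substitution kills the form and changes a polynomial only by a multiple of it, so
  its kernel is the ideal generated by the form. Divisibility becomes vanishing in a domain.\<close>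

lemma linear_form_dvd_iff:
  assumes "a $ i \<noteq> 0"
  shows "linear_form a dvd p \<longleftrightarrow> elim_var a i p = 0"
proof
  assume "linear_form a dvd p"
  then show "elim_var a i p = 0"
    using assms by (auto simp: elim_var_mult elim_var_self elim!: dvdE)
next
  assume "elim_var a i p = 0"
  then show "linear_form a dvd p"
    using linear_form_dvd_diff_elim_var[of a p i] by simp
qed

text \<open>The form generates the kernel of a unital ring homomorphism into a domain, and such a
  kernel is a prime ideal.\<close>

lemma prime_elem_linear_form:
  assumes "a \<noteq> 0"
  shows "prime_elem (linear_form a)"
proof -
  obtain i where i: "a $ i \<noteq> 0"
    using assms by (auto simp: vec_eq_iff)
  show ?thesis
    using assms by (simp add: prime_elem_def linear_form_dvd_iff[OF i] elim_var_mult)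
qed

lemma linear_form_dvd_linear_form:
  assumes "a \<noteq> 0" "linear_form a dvd linear_form b"
  obtains c where "b = c *s a"
proof -
  obtain g where g: "linear_form b = linear_form a * g"
    using assms(2) by (elim dvdE)
  have "homog (1 - 1) g"
    using assms(1) by (intro homog_mult_cancel[of 1 "linear_form a"]) (simp_all flip: g)
  then obtain c where "g = pconst c"
    using homog_0_imp_pconst by auto
  with g have "linear_form b = linear_form (c *s a)"
    by (simp add: linear_form_scale mult.commute)
  then have "b = c *s a"
    by (simp add: linear_form_eq_iff)
  then show ?thesis by (rule that)
qed

section \<open>Divisibility and products of primes\<close>

lemma prime_elem_dvd_prod_iff:
  assumes "prime_elem p" "finite I"
  shows "p dvd (\<Prod>i\<in>I. f i) \<longleftrightarrow> (\<exists>i\<in>I. p dvd f i)"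
  using assms(2)
proof (induction I rule: finite_induct)
  case empty
  then show ?case using prime_elem_not_unit[OF assms(1)] by simp
next
  case (insert i I)
  then show ?case using prime_elem_dvd_mult_iff[OF assms(1)] by simp
qed

text \<open>A further prime divides none of the earlier ones, so it must divide the cofactor left by
  their product.\<close>

lemma prod_prime_elems_dvd:
  assumes "finite I" "\<And>i. i \<in> I \<Longrightarrow> prime_elem (p i)" "\<And>i. i \<in> I \<Longrightarrow> p i dvd x"
    "\<And>i j. i \<in> I \<Longrightarrow> j \<in> I \<Longrightarrow> i \<noteq> j \<Longrightarrow> \<not> p i dvd p j"
  shows "(\<Prod>i\<in>I. p i) dvd (x :: 'a :: idom)"
  using assms
proof (induction I rule: finite_induct)
  case (insert j I)
  have "(\<Prod>i\<in>I. p i) dvd x"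
    by (intro insert.IH insert.prems) auto
  then obtain y where y: "x = (\<Prod>i\<in>I. p i) * y"
    by (rule dvdE)
  have "\<not> p j dvd p i" if "i \<in> I" for i
    using insert.hyps insert.prems(3)[of j i] that by auto
  then have "\<not> p j dvd (\<Prod>i\<in>I. p i)"
    using insert.hyps insert.prems(1)[of j] by (auto simp: prime_elem_dvd_prod_iff)
  then have "p j dvd y"
    using insert.prems y by (auto simp: prime_elem_dvd_mult_iff)
  then show ?case
    using insert.hyps by (simp add: y mult.commute[of "p j"] mult_dvd_mono)
qed simp

text \<open>If \<open>p j * y = g * h\<close> and the prime \<open>p j\<close> does not divide
  \<open>g\<close>, it divides \<open>h\<close> and cancels on both sides.\<close>

lemma dvd_prod_prime_elems_cancel:
  assumes "finite I" "\<And>i. i \<in> I \<Longrightarrow> prime_elem (p i)" "\<And>i. i \<in> I \<Longrightarrow> \<not> p i dvd g"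
    "g dvd (\<Prod>i\<in>I. p i) * y"
  shows "g dvd (y :: 'a :: idom)"
  using assms
proof (induction I arbitrary: y rule: finite_induct)
  case (insert j I)
  have "g dvd (\<Prod>i\<in>I. p i) * (p j * y)"
    using insert.hyps insert.prems(3) by (simp add: mult_ac)
  with insert.prems(1,2) have "g dvd p j * y"
    using insert.IH[of "p j * y"] by blast
  then obtain h where h: "p j * y = g * h" by (elim dvdE)
  have "prime_elem (p j)" "\<not> p j dvd g"
    using insert.prems by auto
  moreover have "p j dvd g * h"
    by (simp flip: h)
  ultimately have "p j dvd h" "p j \<noteq> 0"
    by (simp_all add: prime_elem_dvd_mult_iff)
  then obtain h' where "h = p j * h'" by (elim dvdE)
  with h have "p j * y = p j * (g * h')"
    by (simp add: mult.left_commute)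
  with \<open>p j \<noteq> 0\<close> have "y = g * h'"
    by simp
  then show ?case by simp
qed simp


section \<open>Hyperplanes and logarithmic derivations\<close>

text \<open>The vector is the cross product of \<open>u\<close> and \<open>v\<close>. Its vanishing
  makes all 2x2 minors of the pair zero, so that \<open>v\<close> is a multiple of
  \<open>u\<close>.\<close>

lemma cross_nonzero:
  fixes u v :: "'k::field ^ 3"
  assumes "u \<noteq> 0" "v \<notin> vec.span {u}"
  shows "vector [u $ 2 * v $ 3 - u $ 3 * v $ 2, u $ 3 * v $ 1 - u $ 1 * v $ 3,
    u $ 1 * v $ 2 - u $ 2 * v $ 1] \<noteq> (0 :: 'k ^ 3)"
proof
  assume "vector [u $ 2 * v $ 3 - u $ 3 * v $ 2, u $ 3 * v $ 1 - u $ 1 * v $ 3,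
    u $ 1 * v $ 2 - u $ 2 * v $ 1] = (0 :: 'k ^ 3)"
  then have eq: "u $ i * v $ j = u $ j * v $ i" for i j
    using exhaust_3[of i] exhaust_3[of j] by (auto simp: vec_eq_iff forall_3)
  obtain i where i: "u $ i \<noteq> 0"
    using assms(1) by (auto simp: vec_eq_iff)
  have "v = (v $ i / u $ i) *s u"
    using i eq[of i] by (auto simp: vec_eq_iff field_simps)
  then show False
    using assms(2) vec.span_breakdown_eq[of v u "{}"] by auto
qed

lemma subspace_kernel: "vec.subspace {v :: 'k::field ^ 3. (\<Sum>i\<in>UNIV. a $ i * v $ i) = 0}"
  by (auto simp: vec.subspace_def distrib_left sum.distrib mult.left_commute
      simp flip: sum_distrib_left)

text \<open>The cross product of a basis of \<open>L\<close> is a normal vector: its kernel contains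
  \<open>L\<close> and is a proper subspace, hence has no larger dimension. This justifies the
  choice made in \<open>alpha\<close>.\<close>

lemma hyperplane_imp_kernel:
  fixes L :: "('k::field ^ 3) set"
  assumes "hyperplane_in UNIV L"
  obtains a where "{v. (\<Sum>i\<in>UNIV. a $ i * v $ i) = 0} = L"
proof -
  have L: "vec.subspace L" "vec.dim L = 2"
    using assms by (auto simp: hyperplane_in_def vec_dim_card simp del: vec.dim_UNIV)
  obtain B where B: "finite B" "B \<subseteq> L" "vec.independent B" "vec.span B = L" "card B = vec.dim L"
    using vec.basis_subspace_exists[OF L(1)] by metis
  obtain u v where uv: "B = {u, v}" "u \<noteq> v"
    using B(5) L(2) by (metis card_2_iff)
  define a :: "'k ^ 3" where "a = vector [u $ 2 * v $ 3 - u $ 3 * v $ 2,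
    u $ 3 * v $ 1 - u $ 1 * v $ 3, u $ 1 * v $ 2 - u $ 2 * v $ 1]"
  let ?K = "{v. (\<Sum>i\<in>UNIV. a $ i * v $ i) = 0}"
  have "u \<noteq> 0"
    using B(3) uv vec.dependent_zero by auto
  moreover have "v \<notin> vec.span {u}"
    using B(3) uv vec.independent_insert[of v "{u}"] by (auto simp: insert_commute)
  ultimately have "a \<noteq> 0"
    unfolding a_def by (rule cross_nonzero)
  then obtain i where i: "a $ i \<noteq> 0" by (auto simp: vec_eq_iff)
  have "axis i 1 \<notin> ?K"
    using i by (simp add: axis_def if_distrib[of "\<lambda>x. a $ _ * x"] cong: if_cong)
  then have "?K \<subset> UNIV"
    by blast
  then have "vec.span ?K \<subset> vec.span UNIV"
    unfolding vec.span_eq_iff[THEN iffD2, OF subspace_kernel] vec.span_UNIV .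
  then have "vec.dim ?K \<le> vec.dim L"
    using vec.dim_psubset[of ?K UNIV] L(2) by (simp add: vec_dim_card del: vec.dim_UNIV)
  moreover have "L \<subseteq> ?K"
    unfolding B(4)[symmetric] uv
    by (rule vec.span_minimal[OF _ subspace_kernel])
       (auto simp: a_def sum_3 algebra_simps)
  ultimately have "?K = L"
    using vec.subspace_dim_equal[OF L(1) subspace_kernel, of a] by blast
  then show ?thesis by (rule that)
qed

text \<open>The same choice as in \<open>alpha\<close>, so that \<open>alpha L\<close> is the linear
  form with coefficient vector \<open>normal L\<close>.\<close>

definition normal :: "('k::field ^ 3) set \<Rightarrow> 'k ^ 3" where
  "normal L = (SOME a. {v. (\<Sum>i\<in>UNIV. a $ i * v $ i) = 0} = L)"

lemma alpha_altdef: "alpha L = linear_form (normal L)"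
  by (simp add: alpha_def normal_def)

lemma homog_alpha [simp]: "homog 1 (alpha L)"
  by (simp add: alpha_altdef)

lemma kernel_normal:
  assumes "hyperplane_in UNIV L"
  shows "{v. (\<Sum>i\<in>UNIV. normal L $ i * v $ i) = 0} = L"
  unfolding normal_def using hyperplane_imp_kernel[OF assms] by (rule someI_ex) blast

lemma normal_nonzero:
  assumes "hyperplane_in UNIV L"
  shows "normal L \<noteq> 0"
  using kernel_normal[OF assms] assms by (auto simp: hyperplane_in_def)

lemma prime_elem_alpha: "hyperplane_in UNIV L \<Longrightarrow> prime_elem (alpha L)"
  by (simp add: alpha_altdef prime_elem_linear_form normal_nonzero)

lemma hyperplane_eqI:
  assumes "hyperplane_in UNIV L" "hyperplane_in UNIV L'" "normal L' = c *s normal L"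
  shows "L' = L"
proof -
  have "c \<noteq> 0"
    using assms(3) normal_nonzero[OF assms(2)] by auto
  then have "{v. (\<Sum>i\<in>UNIV. normal L' $ i * v $ i) = 0} = {v. (\<Sum>i\<in>UNIV. normal L $ i * v $ i) = 0}"
    by (simp add: assms(3) mult.assoc flip: sum_distrib_left)
  then show ?thesis
    unfolding kernel_normal[OF assms(1)] kernel_normal[OF assms(2)] .
qed

lemma alpha_dvd_alpha:
  assumes "hyperplane_in UNIV L" "hyperplane_in UNIV L'" "alpha L dvd alpha L'"
  shows "L' = L"
proof -
  obtain c where "normal L' = c *s normal L"
    using assms(3) linear_form_dvd_linear_form[OF normal_nonzero[OF assms(1)], of "normal L'"]
    by (auto simp: alpha_altdef)
  then show ?thesis
    by (rule hyperplane_eqI[OF assms(1,2)])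
qed

section \<open>Defining polynomials\<close>

lemma central_arrangementD:
  "central_arrangement A \<Longrightarrow> finite A"
  "central_arrangement A \<Longrightarrow> L \<in> A \<Longrightarrow> hyperplane_in UNIV L"
  "central_arrangement A \<Longrightarrow> central_arrangement (A - B)"
  by (auto simp: arrangement_in_def)

lemma defpoly_nonzero: "central_arrangement A \<Longrightarrow> defpoly A \<noteq> 0"
  using central_arrangementD(1,2)[of A] prime_elem_alpha
  by (auto simp: defpoly_def prime_elem_def)

lemma homog_defpoly: "homog (int (card A)) (defpoly A)"
  using homog_prod[of A "\<lambda>_. 1" alpha] by (simp add: defpoly_def)

lemma defpoly_remove:
  "central_arrangement A \<Longrightarrow> L \<in> A \<Longrightarrow> defpoly A = alpha L * defpoly (A - {L})"
  unfolding defpoly_def by (intro prod.remove central_arrangementD(1))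

lemma alpha_dvd_defpoly_iff:
  assumes "central_arrangement A" "hyperplane_in UNIV L"
  shows "alpha L dvd defpoly A \<longleftrightarrow> L \<in> A"
  using assms central_arrangementD(1,2)[OF assms(1)] alpha_dvd_alpha[of L]
  by (auto simp: defpoly_def prime_elem_dvd_prod_iff prime_elem_alpha intro: dvd_refl)

lemma defpoly_dvd:
  assumes "central_arrangement A" "\<And>L. L \<in> A \<Longrightarrow> alpha L dvd x"
  shows "defpoly A dvd x"
  unfolding defpoly_def
  using assms central_arrangementD(1,2)[OF assms(1)] alpha_dvd_alpha prime_elem_alpha
  by (intro prod_prime_elems_dvd) blast+

section \<open>The module of logarithmic derivations\<close>

lemma log_der_altdef:
  "log_der A = {\<theta>. \<forall>L\<in>A. alpha L dvd (\<Sum>i\<in>UNIV. \<theta> $ i * pconst (normal L $ i))}"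
  by (simp add: log_der_def alpha_altdef apply_der_linear_form)

lemma log_der_0: "0 \<in> log_der A"
  by (simp add: log_der_altdef)

lemma log_der_add: "\<theta> \<in> log_der A \<Longrightarrow> \<eta> \<in> log_der A \<Longrightarrow> \<theta> + \<eta> \<in> log_der A"
  by (simp add: log_der_altdef distrib_right sum.distrib)

lemma log_der_scale: "\<theta> \<in> log_der A \<Longrightarrow> p *s \<theta> \<in> log_der A"
  by (simp add: log_der_altdef mult.assoc flip: sum_distrib_left)

lemma log_der_diff: "\<theta> \<in> log_der A \<Longrightarrow> \<eta> \<in> log_der A \<Longrightarrow> \<theta> - \<eta> \<in> log_der A"
  by (simp add: log_der_altdef left_diff_distrib sum_subtractf)

lemma log_der_sum: "(\<And>i. i \<in> I \<Longrightarrow> f i \<in> log_der A) \<Longrightarrow> (\<Sum>i\<in>I. f i) \<in> log_der A"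
  by (induction I rule: infinite_finite_induct) (auto intro: log_der_add log_der_0)

lemma log_der_mono: "B \<subseteq> A \<Longrightarrow> log_der A \<subseteq> log_der B"
  by (auto simp: log_der_def)

definition euler :: "'k::field S ^ 3" where
  "euler = (\<chi> i. pvar i)"

text \<open>The Euler derivation maps every linear form to itself.\<close>

lemma euler_in_log_der: "euler \<in> log_der A"
  by (auto simp: log_der_altdef euler_def alpha_altdef linear_form_altdef mult.commute)

text \<open>The factor makes the condition at \<open>H\<close> automatic and, being prime to the
  other \<open>alpha L\<close>, leaves the remaining conditions unchanged.\<close>

lemma alpha_scale_in_log_der_iff:
  assumes "central_arrangement A" "H \<in> A"
  shows "alpha H *s \<phi> \<in> log_der A \<longleftrightarrow> \<phi> \<in> log_der (A - {H})"
proof -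
  have "alpha L dvd alpha H * x \<longleftrightarrow> L = H \<or> alpha L dvd x" if "L \<in> A" for L x
    using assms that central_arrangementD(2)[OF assms(1)]
    by (auto simp: prime_elem_dvd_mult_iff prime_elem_alpha dest: alpha_dvd_alpha)
  then show ?thesis
    by (auto simp: log_der_altdef mult.assoc simp flip: sum_distrib_left)
qed

text \<open>By Cramer's rule, each coefficient of \<open>alpha L\<close> times \<open>det M\<close>
  is a combination of the values of the rows on \<open>alpha L\<close>, which are multiples of
  \<open>alpha L\<close>. Some coefficient is a nonzero scalar.\<close>

lemma defpoly_dvd_det:
  assumes A: "central_arrangement A" and M: "\<And>i. M $ i \<in> log_der A"
  shows "defpoly A dvd det M"
proof (rule defpoly_dvd[OF A])
  fix L assume L: "L \<in> A"
  let ?n = "\<lambda>i. pconst (normal L $ i)"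
  let ?t = "\<lambda>r. \<Sum>i\<in>UNIV. M $ r $ i * ?n i"
  have t: "alpha L dvd ?t r" for r
    using M[of r] L by (auto simp: log_der_altdef)
  have "\<exists>c. ?n i * det M = (\<Sum>r\<in>UNIV. c r * ?t r)" for i
  proof -
    \<comment> \<open>The indices \<open>i\<close>, \<open>j\<close>, \<open>k\<close> are in cyclic
      order; the identity is the expansion along column \<open>i\<close> after that column is
      replaced by the values \<open>?t\<close>.\<close>
    define j k :: 3 where "j = (if i = 1 then 2 else if i = 2 then 3 else 1)"
      and "k = (if i = 1 then 3 else if i = 2 then 1 else 2)"
    have "?n i * det M =
       (M$2$j * M$3$k - M$2$k * M$3$j) * ?t 1 + (M$3$j * M$1$k - M$3$k * M$1$j) * ?t 2 +
       (M$1$j * M$2$k - M$1$k * M$2$j) * ?t 3"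
      using exhaust_3[of i] by (auto simp: j_def k_def det_3 sum_3 algebra_simps)
    then show ?thesis
      by (intro exI[of _ "\<lambda>r. if r = 1 then M$2$j * M$3$k - M$2$k * M$3$j
        else if r = 2 then M$3$j * M$1$k - M$3$k * M$1$j else M$1$j * M$2$k - M$1$k * M$2$j"])
        (simp add: sum_3)
  qed
  moreover obtain i where "normal L $ i \<noteq> 0"
    using normal_nonzero[OF central_arrangementD(2)[OF A L]] by (auto simp: vec_eq_iff)
  ultimately show "alpha L dvd det M"
    using t by (metis (mono_tags, lifting) dvd_sum dvd_mult pconst_mult_dvd_iff)
qed


section \<open>Saito's criterion\<close>

definition replace_row :: "'a ^ 3 ^ 3 \<Rightarrow> 3 \<Rightarrow> 'a ^ 3 \<Rightarrow> 'a ^ 3 ^ 3" where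
  "replace_row M i \<theta> = (\<chi> r. if r = i then \<theta> else M $ r)"

lemma replace_row_nth [simp]: "replace_row M i \<theta> $ r = (if r = i then \<theta> else M $ r)"
  by (simp add: replace_row_def)

lemma cramer_rows:
  fixes M :: "'a::comm_ring_1 ^ 3 ^ 3"
  shows "det M *s \<theta> = (\<Sum>i\<in>UNIV. det (replace_row M i \<theta>) *s M $ i)"
  unfolding vec_eq_iff forall_3 sum_3 det_3
  by (simp add: algebra_simps)

lemma det_replace_row_sum:
  fixes M :: "'a::comm_ring_1 ^ 3 ^ 3"
  shows "det (replace_row M i (\<Sum>l\<in>UNIV. f $ l *s M $ l)) = f $ i * det M"
  using exhaust_3[of i] unfolding sum_3 det_3 by (auto simp: algebra_simps)

lemma homog_det:
  fixes M :: "'k::field S ^ 3 ^ 3"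
  assumes "\<And>r i. homog (d r) (M $ r $ i)"
  shows "homog (\<Sum>r\<in>UNIV. d r) (det M)"
  unfolding det_3 sum_3
  by (intro homog_diff homog_add homog_mult assms)

lemma module_hom_row_combination:
  fixes M :: "'a::comm_ring_1 ^ 3 ^ 3"
  shows "module_hom (*s) (*s) (\<lambda>f. \<Sum>i\<in>UNIV. f $ i *s M $ i)"
  by unfold_locales
    (simp_all add: vec_eq_iff algebra_simps sum.distrib sum_distrib_left)

text \<open>Sufficiency in Saito's criterion: the Cramer coefficients of a logarithmic derivation
  are quotients by \<open>det M\<close>, and these are polynomials because \<open>defpoly A\<close>
  divides every numerator.\<close>

lemma free_with_exponentsI:
  fixes A :: "('k::field ^ 3) set set"
  assumes A: "central_arrangement A"
    and M: "\<And>i. M $ i \<in> log_der A" "\<And>i j. homog (int (d $ i)) (M $ i $ j)"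
    and det: "det M = pconst c * defpoly A" and c: "c \<noteq> 0"
  shows "free_with_exponents A d"
proof -
  define \<Phi> where "\<Phi> = (\<lambda>f. \<Sum>i\<in>UNIV. f $ i *s M $ i)"
  have [simp]: "det M \<noteq> 0"
    using c by (simp add: det defpoly_nonzero[OF A])
  have coeff: "det (replace_row M i (\<Phi> f)) = f $ i * det M" for i f
    unfolding \<Phi>_def by (rule det_replace_row_sum)
  have "inj \<Phi>"
  proof (rule injI)
    fix f g assume "\<Phi> f = \<Phi> g"
    then have "f $ i * det M = g $ i * det M" for i
      using coeff[of i f] coeff[of i g] by simp
    then show "f = g"
      by (simp add: vec_eq_iff)
  qed
  moreover have "\<Phi> f \<in> log_der A" for f
    unfolding \<Phi>_def by (intro log_der_sum log_der_scale M)
  moreover have "\<exists>f. \<theta> = \<Phi> f" if \<theta>: "\<theta> \<in> log_der A" for \<theta>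
  proof -
    have "defpoly A dvd det (replace_row M i \<theta>)" for i
      by (rule defpoly_dvd_det[OF A]) (use M(1) \<theta> in auto)
    then have "\<forall>i. \<exists>g. det (replace_row M i \<theta>) = defpoly A * g"
      by (auto simp: dvd_def)
    then obtain g where g: "\<And>i. det (replace_row M i \<theta>) = defpoly A * g i"
      by metis
    define f where "f = (\<chi> i. pconst (1 / c) * g i)"
    have "det M * f $ i = (pconst c * pconst (1 / c)) * (defpoly A * g i)" for i
      by (simp add: det f_def mult_ac)
    then have "det M * f $ i = det (replace_row M i \<theta>)" for i
      using c by (simp add: g flip: pconst_mult)
    then have "det M *s \<theta> = det M *s \<Phi> f"
      by (simp add: cramer_rows[of M \<theta>] \<Phi>_def vec_eq_iff sum_distrib_left flip: mult.assoc)
    then show ?thesis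
      by (auto simp: vec_eq_iff)
  qed
  ultimately have "bij_betw \<Phi> UNIV (log_der A)"
    unfolding bij_betw_def by blast
  moreover have "(\<forall>i. homog (k - int (d $ i)) (f $ i)) \<longleftrightarrow> (\<forall>i. homog k (\<Phi> f $ i))" for k f
  proof
    assume "\<forall>i. homog (k - int (d $ i)) (f $ i)"
    then have "homog k (f $ l * M $ l $ i)" for l i
      by (intro homog_mult_eq[OF _ M(2)[of l i]]) auto
    then show "\<forall>i. homog k (\<Phi> f $ i)"
      by (auto simp: \<Phi>_def intro: homog_sum)
  next
    assume *: "\<forall>i. homog k (\<Phi> f $ i)"
    show "\<forall>i. homog (k - int (d $ i)) (f $ i)"
    proof
      fix i
      \<comment> \<open>These are the row degrees after row \<open>i\<close> is replaced by an
        element of degree \<open>k\<close>; comparing the two determinants gives the degree of the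
        coefficient.\<close>
      define e where "e r = (if r = i then k else int (d $ r))" for r
      have D: "homog (\<Sum>r\<in>UNIV. int (d $ r)) (det M)"
        by (intro homog_det M)
      have "homog (\<Sum>r\<in>UNIV. e r) (det (replace_row M i (\<Phi> f)))"
        using * M(2) by (intro homog_det) (auto simp: e_def)
      then have "homog ((\<Sum>r\<in>UNIV. e r) - (\<Sum>r\<in>UNIV. int (d $ r))) (f $ i)"
        using D by (intro homog_mult_cancel[OF D]) (simp_all add: coeff mult.commute)
      moreover have "(\<Sum>r\<in>UNIV. e r) - (\<Sum>r\<in>UNIV. int (d $ r)) = k - int (d $ i)"
        using exhaust_3[of i] by (auto simp: sum_3 e_def)
      ultimately show "homog (k - int (d $ i)) (f $ i)" by simp
    qed
  qed
  ultimately show ?thesis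
    unfolding free_with_exponents_def
    using module_hom_row_combination[of M] by (auto simp: \<Phi>_def)
qed

lemma alpha_dvd_defpoly_remove:
  assumes "L \<in> A" "finite A" "L' \<in> A" "L' \<noteq> L"
  shows "alpha L' dvd defpoly (A - {L})"
  unfolding defpoly_def using assms by (intro dvd_prodI) auto

text \<open>If \<open>M\<close> is a basis and \<open>\<alpha>\<^sub>L\<close> divided \<open>det M / Q\<close>, then \<open>\<alpha>\<^sub>L\<^sup>2\<close> would divide every determinant of three
  logarithmic derivations; the derivations \<open>(Q / \<alpha>\<^sub>L) \<partial>\<^sub>v\<close> with \<open>v \<in> L\<close> rule this out.\<close>

lemma exists_det_simple_at:
  assumes A: "central_arrangement A" and L: "L \<in> A"
  obtains N c where "\<And>r. N $ r \<in> log_der A" "c \<noteq> 0"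
    "det N = pconst c * (defpoly (A - {L}) ^ 3 * alpha L)"
proof -
  obtain i where i: "normal L $ i \<noteq> 0"
    using normal_nonzero[OF central_arrangementD(2)[OF A L]] by (auto simp: vec_eq_iff)
  define n where "n = (\<lambda>i. pconst (normal L $ i))"
  define q where "q = defpoly (A - {L})"
  \<comment> \<open>Row \<open>i\<close> is \<alpha>_L q \<partial>_i, and every other row is q (n_i
    \<partial>_r - n_r \<partial>_i), which annihilates \<alpha>_L. Only row \<open>i\<close>
    contributes a factor \<alpha>_L of its own.\<close>
  define N where "N = (\<chi> r j. q * (if r = i then if j = i then alpha L else 0
    else if j = r then n i else if j = i then - n r else 0))"
  show ?thesis
  proof (rule that)
    fix r
    have "alpha L' dvd q" if "L' \<in> A" "L' \<noteq> L" for L'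
      unfolding q_def using alpha_dvd_defpoly_remove L central_arrangementD(1)[OF A] that
      by blast
    then have "alpha L' dvd (\<Sum>j\<in>UNIV. N $ r $ j * pconst (normal L' $ j))"
      if "L' \<in> A" "L' \<noteq> L" for L'
      using that by (simp add: N_def mult.assoc flip: sum_distrib_left)
    moreover have "(\<Sum>j\<in>UNIV. N $ r $ j * n j) = (if r = i then q * alpha L * n i else 0)"
      unfolding sum_3 N_def using exhaust_3[of i] exhaust_3[of r]
      by (auto simp: algebra_simps)
    ultimately have "alpha L' dvd (\<Sum>j\<in>UNIV. N $ r $ j * pconst (normal L' $ j))"
      if "L' \<in> A" for L'
      using that by (cases "L' = L") (auto simp: n_def)
    then show "N $ r \<in> log_der A"
      by (simp add: log_der_altdef)
  next
    show "det N = pconst (normal L $ i ^ 2) * (defpoly (A - {L}) ^ 3 * alpha L)"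
      unfolding det_3 N_def q_def[symmetric] power2_eq_square pconst_mult n_def[symmetric]
      using exhaust_3[of i] by (auto simp: n_def power3_eq_cube algebra_simps)
  qed (use i in simp)
qed

text \<open>Necessity in Saito's criterion, with graded coefficients. The quotient \<open>g\<close>
  of \<open>det M\<close> by \<open>defpoly A\<close> is a unit, since it divides the square of
  \<open>defpoly A\<close> but is divisible by no \<open>alpha L\<close>.\<close>

lemma free_with_exponentsE:
  fixes A :: "('k::field ^ 3) set set"
  assumes A: "central_arrangement A" and free: "free_with_exponents A d"
  obtains M c where "\<And>i. M $ i \<in> log_der A" "\<And>i j. homog (int (d $ i)) (M $ i $ j)"
    "det M = pconst c * defpoly A" "c \<noteq> 0" "int (card A) = (\<Sum>i\<in>UNIV. int (d $ i))"
    "\<And>\<theta> k. \<theta> \<in> log_der A \<Longrightarrow> (\<And>i. homog k (\<theta> $ i)) \<Longrightarrow>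
       \<exists>f. (\<forall>i. homog (k - int (d $ i)) (f $ i)) \<and> \<theta> = (\<Sum>i\<in>UNIV. f $ i *s M $ i)"
proof -
  obtain \<Phi> :: "'k S ^ 3 \<Rightarrow> 'k S ^ 3" where hom: "module_hom (*s) (*s) \<Phi>"
    and bij: "bij_betw \<Phi> UNIV (log_der A)"
    and deg: "\<And>k f. (\<forall>i. homog (k - int (d $ i)) (f $ i)) \<longleftrightarrow> (\<forall>i. homog k (\<Phi> f $ i))"
    using free unfolding free_with_exponents_def by blast
  define M where "M = (\<chi> i. \<Phi> (axis i 1))"
  have expand: "\<Phi> f = (\<Sum>i\<in>UNIV. f $ i *s M $ i)" for f
  proof -
    have "\<Phi> f = \<Phi> (\<Sum>i\<in>UNIV. f $ i *s axis i 1)"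
      by (simp add: basis_expansion)
    also have "\<dots> = (\<Sum>i\<in>UNIV. f $ i *s M $ i)"
      by (simp add: M_def module_hom.sum[OF hom] module_hom.scale[OF hom])
    finally show ?thesis .
  qed
  have M: "M $ i \<in> log_der A" for i
    using bij by (auto simp: M_def bij_betw_def)
  have M_homog: "homog (int (d $ i)) (M $ i $ j)" for i j
  proof -
    have "\<forall>l. homog (int (d $ i) - int (d $ l)) (axis i 1 $ l :: 'k S)"
      by (simp add: axis_def)
    then show ?thesis
      using deg[of "int (d $ i)" "axis i 1"] by (simp add: M_def)
  qed
  have gen: "\<exists>f. \<theta> = (\<Sum>i\<in>UNIV. f $ i *s M $ i)" if "\<theta> \<in> log_der A" for \<theta>
    using that bij expand by (auto simp: bij_betw_def)
  have det_dvd: "det M dvd det N" if "\<And>r. N $ r \<in> log_der A" for N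
  proof -
    have "\<forall>r. \<exists>f. N $ r = (\<Sum>i\<in>UNIV. f $ i *s M $ i)"
      using that gen by blast
    then obtain f where "\<And>r. N $ r = (\<Sum>i\<in>UNIV. f r $ i *s M $ i)"
      by metis
    then have "N = (\<chi> r. f r) ** M"
      by (simp add: vec_eq_iff matrix_matrix_mult_def)
    then show ?thesis
      by (simp add: det_mul)
  qed
  let ?Q = "defpoly A"
  have Q: "?Q \<noteq> 0" by (rule defpoly_nonzero[OF A])
  obtain g where g: "det M = ?Q * g"
    using defpoly_dvd_det[OF A M] by (rule dvdE)
  have not_dvd: "\<not> alpha L dvd g" if L: "L \<in> A" for L
  proof
    assume dvd: "alpha L dvd g"
    obtain N c where N: "\<And>r. N $ r \<in> log_der A" "c \<noteq> 0"
      "det N = pconst c * (defpoly (A - {L}) ^ 3 * alpha L)"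
      using exists_det_simple_at[OF A L] by metis
    define q where "q = defpoly (A - {L})"
    have q: "q \<noteq> 0" "alpha L \<noteq> 0"
      using defpoly_nonzero[OF central_arrangementD(3)[OF A]]
        prime_elem_alpha[OF central_arrangementD(2)[OF A L]]
      by (auto simp: q_def prime_elem_def)
    have "alpha L * q * g dvd alpha L * q * (pconst c * q ^ 2)"
      using det_dvd[OF N(1)]
      by (simp add: g N(3) defpoly_remove[OF A L] algebra_simps power2_eq_square power3_eq_cube
          flip: q_def)
    then have "g dvd pconst c * q ^ 2"
      using q by (simp add: dvd_times_left_cancel_iff)
    then have "g dvd q ^ 2"
      using N(2) by (simp add: pconst_mult_dvd_iff)
    then have "alpha L dvd q ^ 2"
      using dvd by (rule dvd_trans[rotated])
    then have "alpha L dvd q"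
      using prime_elem_dvd_power prime_elem_alpha central_arrangementD(2)[OF A L] by blast
    then show False
      unfolding q_def using alpha_dvd_defpoly_iff[OF central_arrangementD(3)[OF A]]
        central_arrangementD(2)[OF A L] by blast
  qed
  \<comment> \<open>The derivations Q \<partial>_r are logarithmic with determinant Q^3, a multiple
    of \<open>det M\<close> = Q g.\<close>
  have "g dvd ?Q * (?Q * 1)"
  proof -
    define N :: "'k S ^ 3 ^ 3" where "N = (\<chi> r. ?Q *s axis r 1)"
    have "alpha L dvd ?Q" if "L \<in> A" for L
      using alpha_dvd_defpoly_iff[OF A] central_arrangementD(2)[OF A] that by blast
    then have "N $ r \<in> log_der A" for r
      by (simp add: N_def log_der_altdef mult.assoc flip: sum_distrib_left)
    then have "det M dvd det N"
      by (rule det_dvd)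
    also have "det N = ?Q * (?Q * (?Q * 1))"
      by (simp add: N_def det_3 axis_def)
    finally show ?thesis
      using Q by (simp add: g dvd_times_left_cancel_iff)
  qed
  moreover have "g dvd y" if "g dvd ?Q * y" for y
    using that not_dvd central_arrangementD(1,2)[OF A] prime_elem_alpha
    unfolding defpoly_def by (intro dvd_prod_prime_elems_cancel[of A alpha g y]) auto
  ultimately have "g dvd 1"
    by blast
  then obtain h where h: "1 = g * h" by (rule dvdE)
  let ?s = "\<Sum>i\<in>UNIV. int (d $ i)"
  have "homog ?s (?Q * g)"
    using homog_det[of "\<lambda>i. int (d $ i)" M] M_homog by (simp flip: g)
  then have homog_g: "homog (?s - int (card A)) g"
    by (intro homog_mult_cancel[OF homog_defpoly Q])
  have "g \<noteq> 0" "h \<noteq> 0" using h by auto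
  \<comment> \<open>The degrees of \<open>g\<close> and of its inverse are opposite, and neither is
    negative, so both are zero.\<close>
  then have "homog (0 - (?s - int (card A))) h"
    by (intro homog_mult_cancel[OF homog_g]) (simp_all flip: h)
  then have card: "int (card A) = ?s"
    using homog_neg[OF homog_g] homog_neg[of _ h] \<open>g \<noteq> 0\<close> \<open>h \<noteq> 0\<close> by force
  with homog_g obtain c where c: "g = pconst c"
    using homog_0_imp_pconst by auto
  show ?thesis
  proof (rule that)
    show "det M = pconst c * ?Q" "c \<noteq> 0"
      using g c \<open>g \<noteq> 0\<close> by auto
  next
    fix \<theta> k assume \<theta>: "\<theta> \<in> log_der A" "\<And>i. homog k (\<theta> $ i)"
    then obtain f where f: "\<theta> = \<Phi> f"
      using bij by (auto simp: bij_betw_def)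
    then show "\<exists>f. (\<forall>i. homog (k - int (d $ i)) (f $ i)) \<and> \<theta> = (\<Sum>i\<in>UNIV. f $ i *s M $ i)"
      using deg[of k f] \<theta>(2) by (intro exI[of _ f]) (simp flip: expand)
  qed (use M M_homog card in auto)
qed


section \<open>Bases containing the Euler derivation\<close>

lemma pvar_altdef: "pvar i = linear_form (axis i 1)"
proof -
  have "(\<Sum>j\<in>UNIV. pconst (axis i 1 $ j) * pvar j) = (\<Sum>j\<in>UNIV. if j = i then pvar i else 0 :: 'a S)"
    by (intro sum.cong) (auto simp: axis_def)
  then show ?thesis
    by (simp add: linear_form_altdef)
qed

lemma prime_elem_pvar: "prime_elem (pvar i)"
  unfolding pvar_altdef by (rule prime_elem_linear_form) (simp add: axis_eq_0_iff)

lemma pvar_dvd_pvar: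
  assumes "pvar j dvd (pvar k :: 'k::field S)"
  shows "j = k"
proof (rule ccontr)
  assume "j \<noteq> k"
  have "axis j 1 \<noteq> (0 :: 'k ^ 3)"
    by (simp add: axis_eq_0_iff)
  then obtain c where "axis k 1 = c *s (axis j 1 :: 'k ^ 3)"
    using assms linear_form_dvd_linear_form unfolding pvar_altdef by blast
  then have "axis k (1 :: 'k) $ k = c * axis j 1 $ k"
    by simp
  with \<open>j \<noteq> k\<close> show False
    by (simp add: axis_def)
qed

lemma elim_var_idem:
  assumes "n $ i \<noteq> 0"
  shows "elim_var n i (elim_var n i p) = elim_var n i p"
  using linear_form_dvd_diff_elim_var[of n p i] linear_form_dvd_iff[OF assms]
  by (simp add: elim_var_diff)

lemma sum_3_distinct:
  assumes "i \<noteq> j" "i \<noteq> k" "j \<noteq> (k :: 3)"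
  shows "sum f UNIV = f i + f j + f k"
proof -
  have *: "UNIV = {i, j, k}"
    using assms by (intro card_seteq[symmetric]) auto
  show ?thesis
    using assms by (subst *) (simp add: add.assoc)
qed

lemma obtain_other_indices:
  obtains j k where "i \<noteq> j" "i \<noteq> k" "j \<noteq> (k :: 3)"
proof -
  consider "i = 1" | "i = 2" | "i = 3"
    using exhaust_3[of i] by blast
  then show ?thesis
    using that[of 2 3] that[of 1 3] that[of 1 2] by cases simp_all
qed

text \<open>By \<open>tangent\<close>, the coordinates \<open>j\<close> and \<open>k\<close> of
  \<open>\<theta>\<close> on \<open>H\<close> are parallel to those of the Euler derivation. As
  \<open>pvar j\<close> and \<open>pvar k\<close> are non-associated primes, a common polynomial
  factor \<open>f\<close> results; the condition at \<open>H\<close> settles coordinate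
  \<open>i\<close>.\<close>

lemma tangent_to_euler:
  fixes A :: "('k::field ^ 3) set set" and H
  defines "n \<equiv> normal H"
  assumes A: "central_arrangement A" and H: "H \<in> A"
    and \<theta>: "\<theta> \<in> log_der A" "\<And>l. homog d (\<theta> $ l)"
    and i: "n $ i \<noteq> 0" and ijk: "i \<noteq> j" "i \<noteq> k" "j \<noteq> k"
    and tangent: "elim_var n i (\<theta> $ j) * pvar k = elim_var n i (\<theta> $ k) * pvar j"
  obtains f \<phi> where "\<phi> \<in> log_der (A - {H})" "\<And>l. homog (d - 1) (\<phi> $ l)"
    "\<theta> = f *s euler + alpha H *s \<phi>"
proof -
  have \<alpha>: "alpha H = linear_form n"
    by (simp add: n_def alpha_altdef)
  have "pvar j dvd elim_var n i (\<theta> $ j) * pvar k"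
    by (simp add: tangent)
  then have "pvar j dvd elim_var n i (\<theta> $ j)"
    using ijk pvar_dvd_pvar[of j k] by (auto simp: prime_elem_dvd_mult_iff prime_elem_pvar)
  then obtain f where f: "elim_var n i (\<theta> $ j) = pvar j * f"
    by (rule dvdE)
  have nz: "pvar j \<noteq> (0 :: 'k S)"
    using prime_elem_pvar by (auto simp: prime_elem_def)
  have "pvar j * elim_var n i (\<theta> $ k) = elim_var n i (\<theta> $ j) * pvar k"
    by (simp add: tangent)
  also have "\<dots> = pvar j * (f * pvar k)"
    by (simp add: f)
  finally have fk: "elim_var n i (\<theta> $ k) = f * pvar k"
    using mult_left_cancel[OF nz] by blast
  have "pvar j * elim_var n i f = pvar j * f"
    using elim_var_idem[OF i, of "\<theta> $ j"] ijk
    by (simp add: f elim_var_mult elim_var_pvar)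
  then have f_fixed: "elim_var n i f = f"
    using nz by simp
  have "homog d (pvar j * f)"
    unfolding f[symmetric] by (intro homog_elim_var \<theta>)
  then have "homog (d - 1) f"
    by (intro homog_mult_cancel[OF homog_pvar nz])
  then have fx: "homog d (f * pvar l)" for l
    by (rule homog_mult_eq[OF _ homog_pvar]) simp
  have dvd_j: "linear_form n dvd \<theta> $ j - f * pvar j"
    and dvd_k: "linear_form n dvd \<theta> $ k - f * pvar k"
    using ijk by (simp_all add: linear_form_dvd_iff[OF i] elim_var_diff elim_var_mult
        elim_var_pvar f_fixed f fk mult.commute)
  let ?n = "\<lambda>l. pconst (n $ l)"
  have dvd_sum: "linear_form n dvd (\<Sum>l\<in>UNIV. \<theta> $ l * ?n l)"
    using \<theta>(1) H by (auto simp: log_der_altdef \<alpha> n_def alpha_altdef)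
  \<comment> \<open>The value of \<open>\<theta> - f *s euler\<close> on \<alpha>_H is divisible by
    \<alpha>_H, and so are its contributions from \<open>j\<close> and \<open>k\<close>; only the
    one from \<open>i\<close> is left.\<close>
  have "linear_form n dvd (\<Sum>l\<in>UNIV. \<theta> $ l * ?n l) - f * linear_form n
      - ?n j * (\<theta> $ j - f * pvar j) - ?n k * (\<theta> $ k - f * pvar k)"
    by (rule dvd_diff[OF dvd_diff[OF dvd_diff[OF dvd_sum dvd_triv_right]
          dvd_mult[OF dvd_j]] dvd_mult[OF dvd_k]])
  also have "\<dots> = ?n i * (\<theta> $ i - f * pvar i)"
    unfolding linear_form_altdef sum_3_distinct[OF ijk] by (simp add: algebra_simps)
  finally have "linear_form n dvd \<theta> $ i - f * pvar i"
    using i by (simp add: pconst_mult_dvd_iff)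
  then have "linear_form n dvd \<theta> $ l - f * pvar l" for l
    using dvd_j dvd_k ijk exhaust_3[of i] exhaust_3[of j] exhaust_3[of k] exhaust_3[of l]
    by auto
  then have "\<forall>l. \<exists>p. \<theta> $ l - f * pvar l = alpha H * p"
    by (auto simp: \<alpha> dvd_def)
  then obtain p where p: "\<And>l. \<theta> $ l - f * pvar l = alpha H * p l"
    by metis
  define \<phi> where "\<phi> = (\<chi> l. p l)"
  have eq: "\<theta> - f *s euler = alpha H *s \<phi>"
    by (simp add: vec_eq_iff p euler_def \<phi>_def)
  show ?thesis
  proof (rule that)
    have "\<theta> - f *s euler \<in> log_der A"
      by (intro log_der_diff log_der_scale \<theta> euler_in_log_der)
    then show "\<phi> \<in> log_der (A - {H})"
      by (simp add: eq alpha_scale_in_log_der_iff[OF A H])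
  next
    fix l
    have "homog d (alpha H * \<phi> $ l)"
      unfolding \<phi>_def vec_lambda_beta p[symmetric] by (intro homog_diff \<theta> fx)
    moreover have "alpha H \<noteq> 0"
      using prime_elem_alpha[OF central_arrangementD(2)[OF A H]] by (auto simp: prime_elem_def)
    ultimately show "homog (d - 1) (\<phi> $ l)"
      using homog_mult_cancel[OF homog_alpha] by blast
  next
    show "\<theta> = f *s euler + alpha H *s \<phi>"
      by (simp flip: eq)
  qed
qed

text \<open>The multiple of the first row inside row \<open>r\<close> does not affect the
  determinant, so replacing row \<open>r\<close> by \<open>\<phi>\<close> divides the determinant by
  \<open>alpha H\<close>, as Saito's criterion for the deletion requires.\<close>

lemma free_deletionI:
  fixes A :: "('k::field ^ 3) set set" and d :: "3 \<Rightarrow> nat"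
  assumes A: "central_arrangement A" and H: "H \<in> A"
    and M: "\<And>r. M $ r \<in> log_der A" "\<And>r l. homog (int (d r)) (M $ r $ l)"
    and det: "det M = pconst c * defpoly A" "c \<noteq> 0"
    and euler: "M $ 1 = euler" and r: "r \<noteq> 1" "1 \<le> d r"
    and i: "normal H $ i \<noteq> 0" and ijk: "i \<noteq> j" "i \<noteq> k" "j \<noteq> k"
    and tangent: "elim_var (normal H) i (M $ r $ j) * pvar k =
      elim_var (normal H) i (M $ r $ k) * pvar j"
  shows "free_arrangement (A - {H})"
proof -
  obtain f \<phi> where \<phi>: "\<phi> \<in> log_der (A - {H})" "\<And>l. homog (int (d r) - 1) (\<phi> $ l)"
    and eq: "M $ r = f *s euler + alpha H *s \<phi>"
    using tangent_to_euler[OF A H M i ijk tangent] by metis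
  define N where "N = replace_row M r \<phi>"
  have "alpha H * det N = det M"
    using r(1) exhaust_3[of r] eq unfolding N_def det_3
    by (auto simp: euler algebra_simps)
  also have "\<dots> = alpha H * (pconst c * defpoly (A - {H}))"
    by (simp add: det defpoly_remove[OF A H] mult_ac)
  finally have "det N = pconst c * defpoly (A - {H})"
    using prime_elem_alpha[OF central_arrangementD(2)[OF A H]] by (auto simp: prime_elem_def)
  moreover have "N $ l \<in> log_der (A - {H})" for l
    using M(1)[of l] \<phi>(1) log_der_mono[of "A - {H}" A] by (auto simp: N_def)
  \<comment> \<open>The natural subtraction is exact because \<open>1 \<le> d r\<close>.\<close>
  moreover have "homog (int ((\<chi> l. if l = r then d r - 1 else d l) $ l)) (N $ l $ m)" for l m
    using M(2) \<phi>(2) r(2) by (simp add: N_def of_nat_diff)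
  ultimately have "free_with_exponents (A - {H}) (\<chi> l. if l = r then d r - 1 else d l)"
    using det(2) central_arrangementD(3)[OF A] by (intro free_with_exponentsI[where M = N]) auto
  then show ?thesis
    by (auto simp: free_arrangement_def)
qed

text \<open>The determinant condition is that of Saito's criterion: for a central arrangement the
  rows form a homogeneous basis of D(A) of degrees 1, \<open>a\<close>, \<open>b\<close>.\<close>

definition euler_basis :: "('k::field ^ 3) set set \<Rightarrow> nat \<Rightarrow> nat \<Rightarrow> 'k S ^ 3 ^ 3 \<Rightarrow> bool" where
  "euler_basis A a b M \<longleftrightarrow> (\<forall>r. M $ r \<in> log_der A) \<and>
     (\<forall>r l. homog (int (vector [1, a, b] $ r)) (M $ r $ l)) \<and>
     M $ 1 = euler \<and> (\<exists>c. c \<noteq> 0 \<and> det M = pconst c * defpoly A)"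

lemma euler_basisD:
  assumes "euler_basis A a b M"
  shows "M $ r \<in> log_der A" "homog 1 (M $ 1 $ l)" "homog (int a) (M $ 2 $ l)"
    "homog (int b) (M $ 3 $ l)" "M $ 1 = euler" "\<exists>c. c \<noteq> 0 \<and> det M = pconst c * defpoly A"
  using assms vector_3[of 1 a b] unfolding euler_basis_def
  by (metis of_nat_1)+

lemma euler_basis_replace:
  assumes "euler_basis A a b M" and "r \<noteq> 1" and "\<theta> \<in> log_der A"
    and "\<And>l. homog (int (vector [1, a, b] $ r)) (\<theta> $ l)"
    and "det (replace_row M r \<theta>) = pconst c * det M" "c \<noteq> 0"
  shows "euler_basis A a b (replace_row M r \<theta>)"
proof -
  obtain c' where "c' \<noteq> 0" "det M = pconst c' * defpoly A"
    using euler_basisD(6)[OF assms(1)] by blast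
  then have "c * c' \<noteq> 0" "det (replace_row M r \<theta>) = pconst (c * c') * defpoly A"
    using assms(5,6) by (simp_all add: pconst_mult)
  then have "\<exists>c. c \<noteq> 0 \<and> det (replace_row M r \<theta>) = pconst c * defpoly A"
    by blast
  then show ?thesis
    using assms(1-4) unfolding euler_basis_def by simp
qed

lemma free_deletion_of_euler_basis:
  assumes "central_arrangement A" "H \<in> A" "euler_basis A a b M" "1 \<le> a" "1 \<le> b" "r \<noteq> 1"
    "normal H $ i \<noteq> 0" "i \<noteq> j" "i \<noteq> k" "j \<noteq> k"
    "elim_var (normal H) i (M $ r $ j) * pvar k = elim_var (normal H) i (M $ r $ k) * pvar j"
  shows "free_arrangement (A - {H})"
proof -
  obtain c where "c \<noteq> 0" "det M = pconst c * defpoly A"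
    using euler_basisD(6)[OF assms(3)] by blast
  moreover have "1 \<le> vector [1, a, b] $ r"
    using assms(4,5) exhaust_3[of r] by auto
  ultimately show ?thesis
    using assms(3) unfolding euler_basis_def
    by (intro free_deletionI[OF assms(1,2) _ _ _ _ _ assms(6) _ assms(7-11),
          where d = "\<lambda>r. vector [1, a, b] $ r"]) auto
qed

text \<open>In the expansion of the Euler derivation, a nonzero coefficient can only belong to a
  basis element of degree 1 and is a scalar, so the two can be exchanged.\<close>

lemma euler_basis_exists:
  fixes A :: "('k::field ^ 3) set set"
  assumes A: "central_arrangement A" and free: "free_with_exponents A (vector [1, a, b])"
    and ab: "1 \<le> a" "1 \<le> b"
  obtains M where "euler_basis A a b M"
proof -
  define d :: "nat ^ 3" where "d = vector [1, a, b]"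
  obtain M c where M: "\<And>i. M $ i \<in> log_der A" "\<And>i j. homog (int (d $ i)) (M $ i $ j)"
    "det M = pconst c * defpoly A" "c \<noteq> 0"
    and gen: "\<And>\<theta> k. \<theta> \<in> log_der A \<Longrightarrow> (\<And>i. homog k (\<theta> $ i)) \<Longrightarrow>
       \<exists>f. (\<forall>i. homog (k - int (d $ i)) (f $ i)) \<and> \<theta> = (\<Sum>i\<in>UNIV. f $ i *s M $ i)"
    by (rule free_with_exponentsE[OF A free, folded d_def], rule that) (assumption | blast)+
  have "\<exists>f. (\<forall>i. homog (1 - int (d $ i)) (f $ i)) \<and> euler = (\<Sum>i\<in>UNIV. f $ i *s M $ i)"
    by (rule gen[OF euler_in_log_der]) (simp add: euler_def)
  then obtain f where f: "\<And>i. homog (1 - int (d $ i)) (f $ i)"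
    and eq: "euler = (\<Sum>i\<in>UNIV. f $ i *s M $ i)"
    by blast
  have "euler $ 1 \<noteq> (0 :: 'k S)"
    using prime_elem_pvar[of 1] by (auto simp: euler_def prime_elem_def)
  then have "f \<noteq> 0"
    using eq by auto
  then obtain i where i: "f $ i \<noteq> 0"
    by (auto simp: vec_eq_iff)
  have "1 \<le> d $ i"
    using ab exhaust_3[of i] by (auto simp: d_def)
  moreover have "\<not> 1 - int (d $ i) < 0"
    using homog_neg[OF f[of i]] i by blast
  ultimately have di: "d $ i = 1"
    by linarith
  then obtain c' where c': "f $ i = pconst c'"
    using f[of i] homog_0_imp_pconst by auto
  \<comment> \<open>The old first element moves to position \<open>i\<close>, whose degree is also
    1. For \<open>i \<noteq> 1\<close> this swap changes the sign of the determinant.\<close>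
  define N where "N = (\<chi> r. if r = 1 then euler else if r = i then M $ 1 else M $ r)"
  have "det (replace_row M i euler) = pconst (c' * c) * defpoly A"
    by (simp add: eq det_replace_row_sum c' M(3) pconst_mult)
  moreover have "det N = (if i = 1 then 1 else - 1) * det (replace_row M i euler)"
    unfolding det_3 N_def using exhaust_3[of i] by (auto simp: algebra_simps)
  ultimately have "det N = pconst ((if i = 1 then 1 else - 1) * (c' * c)) * defpoly A"
    by (simp add: pconst_uminus)
  moreover have "c' * c \<noteq> 0"
    using c' i M(4) by auto
  moreover have "N $ r \<in> log_der A" for r
    by (simp add: N_def M euler_in_log_der)
  moreover have "homog (int (d $ r)) (N $ r $ l)" for r l
  proof -
    have "d $ 1 = 1" by (simp add: d_def)
    then show ?thesis
      using M(2)[of 1 l] M(2)[of r l] di by (simp add: N_def euler_def)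
  qed
  moreover have "N $ 1 = euler"
    by (simp add: N_def)
  ultimately have "euler_basis A a b N"
    unfolding euler_basis_def d_def
    by (intro conjI exI[of _ "(if i = 1 then 1 else - 1) * (c' * c)"]) auto
  then show ?thesis by (rule that)
qed


section \<open>Sufficient conditions for a free deletion\<close>

text \<open>With \<open>\<lambda> = b\<^sub>j x\<^sub>j + b\<^sub>k x\<^sub>k\<close> the restriction of \<open>\<alpha>\<^sub>L\<close> to \<open>H\<close>, both \<open>b\<^sub>j\<close> and \<open>b\<^sub>k\<close> times the
  left-hand side are multiples of \<open>\<lambda>\<close>.\<close>

lemma restricted_form_dvd:
  fixes A :: "('k::field ^ 3) set set"
  assumes A: "central_arrangement A" and H: "H \<in> A" and L: "L \<in> A" "L \<noteq> H"
    and \<theta>: "\<theta> \<in> log_der A"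
    and i: "normal H $ i \<noteq> 0" and ijk: "i \<noteq> j" "i \<noteq> k" "j \<noteq> k"
  shows "elim_var (normal H) i (alpha L) dvd
    elim_var (normal H) i (\<theta> $ j) * pvar k - elim_var (normal H) i (\<theta> $ k) * pvar j"
proof -
  define n where "n = normal H"
  define t where "t = normal L $ i / n $ i"
  define b where "b = normal L - t *s n"
  let ?s = "elim_var n i" and ?b = "\<lambda>l. pconst (b $ l)"
  have b_i: "b $ i = 0"
    using i by (simp add: b_def t_def n_def)
  have \<lambda>: "?s (alpha L) = linear_form b"
    by (simp add: alpha_altdef elim_var_linear_form b_def t_def)
  have "?s (\<Sum>l\<in>UNIV. \<theta> $ l * pconst (n $ l)) = 0"
    using \<theta> H linear_form_dvd_iff[OF i] by (auto simp: log_der_altdef n_def alpha_altdef)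
  then have tangent_H: "(\<Sum>l\<in>UNIV. ?s (\<theta> $ l) * pconst (n $ l)) = 0"
    by (simp add: elim_var_sum elim_var_mult)
  obtain g where g: "(\<Sum>l\<in>UNIV. \<theta> $ l * pconst (normal L $ l)) = alpha L * g"
    using \<theta> L(1) by (auto simp: log_der_altdef elim: dvdE)
  \<comment> \<open>Since \<open>\<theta>\<close> is tangent to \<open>H\<close>, the multiple of
    \<open>n\<close> subtracted in \<open>b\<close> does not contribute after reduction.\<close>
  have "(\<Sum>l\<in>UNIV. ?s (\<theta> $ l) * ?b l) =
      (\<Sum>l\<in>UNIV. ?s (\<theta> $ l) * pconst (normal L $ l)) -
      pconst t * (\<Sum>l\<in>UNIV. ?s (\<theta> $ l) * pconst (n $ l))"
    by (simp add: b_def pconst_diff pconst_mult algebra_simps sum_subtractf sum_distrib_left)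
  also have "\<dots> = ?s (\<Sum>l\<in>UNIV. \<theta> $ l * pconst (normal L $ l))"
    by (simp add: tangent_H elim_var_sum elim_var_mult)
  also have "\<dots> = linear_form b * ?s g"
    by (simp add: g elim_var_mult \<lambda>)
  finally have tangent_L: "?s (\<theta> $ j) * ?b j + ?s (\<theta> $ k) * ?b k = linear_form b * ?s g"
    by (simp add: sum_3_distinct[OF ijk] b_i)
  have lf: "linear_form b = ?b j * pvar j + ?b k * pvar k"
    by (simp add: linear_form_altdef sum_3_distinct[OF ijk] b_i)
  let ?\<rho> = "?s (\<theta> $ j) * pvar k - ?s (\<theta> $ k) * pvar j"
  have "?b k * ?\<rho> = linear_form b * ?s (\<theta> $ j) -
      pvar j * (?s (\<theta> $ j) * ?b j + ?s (\<theta> $ k) * ?b k)"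
    by (simp add: lf algebra_simps)
  then have dvd_k: "linear_form b dvd ?b k * ?\<rho>"
    by (simp add: tangent_L)
  have "?b j * ?\<rho> = pvar k * (?s (\<theta> $ j) * ?b j + ?s (\<theta> $ k) * ?b k) -
      linear_form b * ?s (\<theta> $ k)"
    by (simp add: lf algebra_simps)
  then have dvd_j: "linear_form b dvd ?b j * ?\<rho>"
    by (simp add: tangent_L)
  have "b \<noteq> 0"
    using hyperplane_eqI[OF central_arrangementD(2)[OF A H] central_arrangementD(2)[OF A L(1)], of t] L(2)
    by (auto simp: b_def n_def)
  then have "b $ j \<noteq> 0 \<or> b $ k \<noteq> 0"
    using lf by auto
  then show ?thesis
    using dvd_j dvd_k unfolding n_def[symmetric] \<lambda> by (auto simp: pconst_mult_dvd_iff)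
qed

text \<open>Subtracting a multiple of \<open>normal H\<close> from \<open>normal L\<close>
  eliminates coordinate \<open>i\<close> and preserves the intersection with \<open>H\<close>. The
  result is nonzero as \<open>L \<noteq> H\<close>, and proportional results cut the same line out
  of \<open>H\<close>.\<close>

lemma elim_var_alpha:
  assumes A: "central_arrangement A" and H: "H \<in> A" and L: "L \<in> A" "L \<noteq> H"
    and i: "normal H $ i \<noteq> 0"
  shows "prime_elem (elim_var (normal H) i (alpha L))"
    and "L' \<in> A \<Longrightarrow> L' \<noteq> H \<Longrightarrow>
      elim_var (normal H) i (alpha L) dvd elim_var (normal H) i (alpha L') \<Longrightarrow> H \<inter> L = H \<inter> L'"
proof -
  define b where "b = (\<lambda>L. normal L - (normal L $ i / normal H $ i) *s normal H)"
  have b: "elim_var (normal H) i (alpha L) = linear_form (b L)" for L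
    by (simp add: alpha_altdef elim_var_linear_form b_def)
  have nz: "b L \<noteq> 0" if "L \<in> A" "L \<noteq> H" for L
    using hyperplane_eqI[OF central_arrangementD(2)[OF A H] central_arrangementD(2)[OF A that(1)]] that(2)
    by (auto simp: b_def)
  have ker: "H \<inter> L = {v. (\<Sum>l\<in>UNIV. normal H $ l * v $ l) = 0 \<and> (\<Sum>l\<in>UNIV. b L $ l * v $ l) = 0}"
    if "L \<in> A" for L
  proof -
    have "(\<Sum>l\<in>UNIV. b L $ l * v $ l) = (\<Sum>l\<in>UNIV. normal L $ l * v $ l) -
        (normal L $ i / normal H $ i) * (\<Sum>l\<in>UNIV. normal H $ l * v $ l)" for v
      by (simp add: b_def algebra_simps sum_subtractf sum_distrib_left)
    moreover have "v \<in> K \<longleftrightarrow> (\<Sum>l\<in>UNIV. normal K $ l * v $ l) = 0" if "K \<in> A" for v K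
      using kernel_normal[OF central_arrangementD(2)[OF A that]] by blast
    ultimately show ?thesis
      using H that by (auto simp: set_eq_iff)
  qed
  show "prime_elem (elim_var (normal H) i (alpha L))"
    unfolding b by (rule prime_elem_linear_form[OF nz[OF L]])
  assume L': "L' \<in> A" "L' \<noteq> H"
    and dvd: "elim_var (normal H) i (alpha L) dvd elim_var (normal H) i (alpha L')"
  obtain c where c: "b L' = c *s b L"
    using linear_form_dvd_linear_form[OF nz[OF L] dvd[unfolded b]] .
  then have "c \<noteq> 0"
    using nz[OF L'] by auto
  then show "H \<inter> L = H \<inter> L'"
    unfolding ker[OF L(1)] ker[OF L'(1)]
    by (simp add: c mult.assoc flip: sum_distrib_left)
qed

text \<open>On \<open>H\<close> the basis elements of degrees \<open>a\<close> and \<open>b\<close> are measured by their determinants with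
  the Euler derivation; these are multiples of the defining polynomial of \<open>\<A>\<^sup>H\<close>, whose degree is
  that of the first determinant.\<close>

lemma free_deletion_if_card_restriction:
  fixes A :: "('k::field ^ 3) set set"
  assumes A: "central_arrangement A" and H: "H \<in> A" and M: "euler_basis A a b M"
    and ab: "1 \<le> a" "a \<le> b" and card: "card (restriction A H) = a + 1"
  shows "free_arrangement (A - {H})"
proof -
  obtain i where i: "normal H $ i \<noteq> 0"
    using normal_nonzero[OF central_arrangementD(2)[OF A H]] by (auto simp: vec_eq_iff)
  obtain j k where ijk: "i \<noteq> j" "i \<noteq> k" "j \<noteq> k"
    using obtain_other_indices by metis
  let ?s = "elim_var (normal H) i"
  define \<rho> where "\<rho> \<theta> = ?s (\<theta> $ j) * pvar k - ?s (\<theta> $ k) * pvar j" for \<theta> :: "'k S ^ 3"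
  have \<rho>_fixed: "?s (\<rho> \<theta>) = \<rho> \<theta>" for \<theta>
    using ijk by (simp add: \<rho>_def elim_var_diff elim_var_mult elim_var_idem[OF i] elim_var_pvar)
  have freeI: "free_arrangement (A - {H})" if "euler_basis A a b N" "r \<noteq> 1" "\<rho> (N $ r) = 0" for N r
    using free_deletion_of_euler_basis[OF A H that(1) _ _ that(2) i ijk] ab that(3)
    by (simp add: \<rho>_def)
  \<comment> \<open>One hyperplane is chosen for each line of the restriction, so the restricted
    forms of \<open>P\<close> are pairwise non-associated and their product has degree
    \<open>a + 1\<close>.\<close>
  obtain P where P: "P \<subseteq> A - {H}" "inj_on (\<lambda>L. H \<inter> L) P" "restriction A H = (\<lambda>L. H \<inter> L) ` P"
    using subset_image_inj[of "restriction A H" "\<lambda>L. H \<inter> L" "A - {H}"]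
    by (auto simp: restriction_def)
  have fin: "finite P"
    using P(1) central_arrangementD(1)[OF A] finite_subset by blast
  have cardP: "card P = a + 1"
    using card P by (simp add: card_image)
  define \<beta> where "\<beta> = (\<Prod>L\<in>P. ?s (alpha L))"
  have prime: "prime_elem (?s (alpha L))" if "L \<in> P" for L
    using elim_var_alpha(1)[OF A H _ _ i] P(1) that by blast
  have \<beta>_dvd: "\<beta> dvd \<rho> \<theta>" if "\<theta> \<in> log_der A" for \<theta>
    unfolding \<beta>_def
  proof (rule prod_prime_elems_dvd[OF fin prime])
    show "?s (alpha L) dvd \<rho> \<theta>" if "L \<in> P" for L
      unfolding \<rho>_def using restricted_form_dvd[OF A H _ _ \<open>\<theta> \<in> log_der A\<close> i ijk] P(1) that by blast
    show "\<not> ?s (alpha L) dvd ?s (alpha L')" if "L \<in> P" "L' \<in> P" "L \<noteq> L'" for L L'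
      using elim_var_alpha(2)[OF A H _ _ i, of L L'] P that by (auto dest: inj_onD)
  qed
  have \<beta>_nz: "\<beta> \<noteq> 0"
    using prime fin by (auto simp: \<beta>_def prime_elem_def)
  have \<beta>_fixed: "?s \<beta> = \<beta>"
    by (simp add: \<beta>_def elim_var_prod elim_var_idem[OF i])
  have \<beta>_homog: "homog (int a + 1) \<beta>"
    using homog_prod[of P "\<lambda>_. 1" "\<lambda>L. ?s (alpha L)"] cardP
    by (simp add: \<beta>_def homog_elim_var add.commute)
  have \<rho>_homog: "homog (e + 1) (\<rho> \<theta>)" if "\<And>l. homog e (\<theta> $ l)" for \<theta> e
    unfolding \<rho>_def using that by (intro homog_diff homog_mult homog_elim_var) auto
  show ?thesis
  proof (cases "\<rho> (M $ 2) = 0")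
    case True
    then show ?thesis using freeI[OF M, of 2] by simp
  next
    case False
    obtain u where u: "\<rho> (M $ 2) = \<beta> * u"
      using \<beta>_dvd[OF euler_basisD(1)[OF M]] by (rule dvdE)
    obtain g where g: "\<rho> (M $ 3) = \<beta> * g"
      using \<beta>_dvd[OF euler_basisD(1)[OF M]] by (rule dvdE)
    have "homog (int a + 1) (\<beta> * u)" "homog (int b + 1) (\<beta> * g)"
      unfolding u[symmetric] g[symmetric] using euler_basisD(3,4)[OF M] \<rho>_homog by blast+
    then have "homog (int a + 1 - (int a + 1)) u" "homog (int b + 1 - (int a + 1)) g"
      using homog_mult_cancel[OF \<beta>_homog \<beta>_nz] by blast+
    \<comment> \<open>Both \<open>\<rho> (M $ 2)\<close> and \<open>\<beta>\<close> have degree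
      \<open>a + 1\<close>, so their quotient is a scalar.\<close>
    then have u_homog: "homog 0 u" and g_homog: "homog (int b - int a) g"
      by simp_all
    obtain c where c: "u = pconst c"
      using homog_0_imp_pconst[OF u_homog] .
    have "c \<noteq> 0"
      using False u c by auto
    have "\<beta> * ?s g = \<beta> * g"
      using \<rho>_fixed[of "M $ 3"] by (simp add: g elim_var_mult \<beta>_fixed)
    then have g_fixed: "?s g = g"
      using \<beta>_nz by simp
    \<comment> \<open>Chosen to cancel \<open>\<rho> (M $ 3)\<close> against
      \<open>\<rho> (M $ 2)\<close>. The substitution fixes \<open>g\<close>, so \<open>h\<close>
      passes through \<open>\<rho>\<close> unchanged.\<close>
    define h where "h = pconst (1 / c) * g"
    define \<theta> where "\<theta> = M $ 3 - h *s M $ 2"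
    have "\<rho> \<theta> = \<rho> (M $ 3) - ?s h * \<rho> (M $ 2)"
      by (simp add: \<theta>_def \<rho>_def elim_var_diff elim_var_mult algebra_simps)
    also have "\<dots> = \<beta> * g - (pconst (1 / c) * pconst c) * (\<beta> * g)"
      by (simp add: g u c h_def elim_var_mult g_fixed mult_ac)
    also have "\<dots> = 0"
      using \<open>c \<noteq> 0\<close> by (simp flip: pconst_mult)
    finally have \<rho>_0: "\<rho> \<theta> = 0" .
    have "homog (int b - int a) h"
      unfolding h_def by (rule homog_mult_eq[OF homog_pconst g_homog]) simp
    then have "homog (int b) (\<theta> $ l)" for l
      unfolding \<theta>_def using euler_basisD(3,4)[OF M, of l]
      by (auto intro!: homog_diff homog_mult_eq[where d = "int b - int a" and e = "int a"])
    moreover have "\<theta> \<in> log_der A"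
      unfolding \<theta>_def by (intro log_der_diff log_der_scale euler_basisD(1)[OF M])
    moreover have "det (replace_row M 3 \<theta>) = pconst 1 * det M"
      by (simp add: det_3 \<theta>_def algebra_simps)
    ultimately have "euler_basis A a b (replace_row M 3 \<theta>)"
      by (intro euler_basis_replace[OF M, where c = 1]) simp_all
    then show ?thesis
      using freeI[of "replace_row M 3 \<theta>" 3] \<rho>_0 by simp
  qed
qed

text \<open>In coordinates, \<open>\<alpha>\<^sub>L dvd \<eta>\<^sub>j n\<^sub>k - \<eta>\<^sub>k n\<^sub>j\<close> says that \<open>\<eta> / Q\<close> is a logarithmic form.
  Pairing it with the basis kills the Euler derivation for degree reasons, so that
  \<open>\<alpha>\<^sub>H \<eta>\<close> is a scalar multiple of \<open>euler \<times> w\<close>, with \<open>w\<close> a combination of the other two basis elements.\<close>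

lemma free_deletion_if_log_form:
  fixes A :: "('k::field ^ 3) set set" and \<eta> :: "'k S ^ 3"
  assumes A: "central_arrangement A" and H: "H \<in> A" and M: "euler_basis A a b M"
    and ab: "1 \<le> a" "a \<le> b" "2 \<le> b"
    and \<eta>: "\<And>L j k. L \<in> A - {H} \<Longrightarrow>
        alpha L dvd \<eta> $ j * pconst (normal L $ k) - \<eta> $ k * pconst (normal L $ j)"
      "\<And>l. homog (int (card (A - {H})) - int b) (\<eta> $ l)" "\<eta> \<noteq> 0"
  shows "free_arrangement (A - {H})"
proof -
  define Q where "Q = defpoly (A - {H})"
  have B: "central_arrangement (A - {H})"
    by (rule central_arrangementD(3)[OF A])
  have Q: "Q \<noteq> 0" "homog (int (card (A - {H}))) Q"
    by (simp_all add: Q_def defpoly_nonzero[OF B] homog_defpoly)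
  \<comment> \<open>Modulo \<open>alpha L\<close> the vector \<open>\<eta>\<close> is parallel to
    the normal of \<open>L\<close>, so its pairing with \<open>\<theta>\<close> is, up to a nonzero
    scalar, a multiple of the value of \<open>\<theta>\<close> on \<open>alpha L\<close>.\<close>
  have pairing: "Q dvd (\<Sum>l\<in>UNIV. \<eta> $ l * \<theta> $ l)" if \<theta>: "\<theta> \<in> log_der A" for \<theta>
    unfolding Q_def
  proof (rule defpoly_dvd[OF B])
    fix L assume L: "L \<in> A - {H}"
    let ?n = "\<lambda>l. pconst (normal L $ l)"
    obtain i where i: "normal L $ i \<noteq> 0"
      using normal_nonzero[OF central_arrangementD(2)[OF B L]] by (auto simp: vec_eq_iff)
    have "alpha L dvd (\<Sum>l\<in>UNIV. \<theta> $ l * ?n l)"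
      using \<theta> L by (auto simp: log_der_altdef)
    then have "alpha L dvd \<eta> $ i * (\<Sum>l\<in>UNIV. \<theta> $ l * ?n l) +
        (\<Sum>l\<in>UNIV. (\<eta> $ l * ?n i - \<eta> $ i * ?n l) * \<theta> $ l)"
      using \<eta>(1)[OF L] by (intro dvd_add dvd_sum) auto
    also have "\<dots> = ?n i * (\<Sum>l\<in>UNIV. \<eta> $ l * \<theta> $ l)"
      by (simp add: sum_distrib_left algebra_simps flip: sum.distrib)
    finally show "alpha L dvd (\<Sum>l\<in>UNIV. \<eta> $ l * \<theta> $ l)"
      using i by (simp add: pconst_mult_dvd_iff)
  qed
  have "\<forall>r. \<exists>p. (\<Sum>l\<in>UNIV. \<eta> $ l * M $ r $ l) = Q * p"
    using pairing[OF euler_basisD(1)[OF M]] by (auto simp: dvd_def)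
  then obtain p where p: "\<And>r. (\<Sum>l\<in>UNIV. \<eta> $ l * M $ r $ l) = Q * p r"
    by metis
  have p_homog: "homog (int e - int b) (p r)" if "\<And>l. homog (int e) (M $ r $ l)" for r e
  proof -
    have "homog (int (card (A - {H})) - int b + int e) (Q * p r)"
      unfolding p[symmetric] by (intro homog_sum homog_mult \<eta>(2) that)
    from homog_mult_cancel[OF Q(2,1) this] show ?thesis
      by (simp add: algebra_simps)
  qed
  \<comment> \<open>The degree is 1 - \<open>b\<close>, which is negative since \<open>b\<close> is
    at least 2.\<close>
  have p1: "p 1 = 0"
    using p_homog[of 1 1] euler_basisD(2)[OF M] ab by (auto intro: homog_neg)
  have p2: "homog (int a - int b) (p 2)" and p3: "homog 0 (p 3)"
    using p_homog[of a 2] p_homog[of b 3] euler_basisD(3,4)[OF M] by auto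
  obtain c3 where c3: "p 3 = pconst c3"
    using homog_0_imp_pconst[OF p3] .
  obtain c where c: "c \<noteq> 0" "det M = pconst c * defpoly A"
    using euler_basisD(6)[OF M] by blast
  define w where "w = p 3 *s M $ 2 - p 2 *s M $ 3"
  define cross where "cross = (\<lambda>j k. w $ j * euler $ k - w $ k * euler $ j :: 'k S)"
  \<comment> \<open>Cramer's rule recovers \<open>\<eta>\<close> from its pairings with the three
    rows; the triples are the cyclic orders of the indices.\<close>
  have expand: "det M * \<eta> $ l = Q * (p 1 * (M $ 2 $ j * M $ 3 $ k - M $ 2 $ k * M $ 3 $ j) - cross j k)"
    if "(l, j, k) \<in> {(1, 2, 3), (2, 3, 1), (3, 1, 2)}" for l j k :: 3
  proof -
    have "det M * \<eta> $ l =
        (Q * p 1) * (M $ 2 $ j * M $ 3 $ k - M $ 2 $ k * M $ 3 $ j) +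
        (Q * p 2) * (M $ 3 $ j * M $ 1 $ k - M $ 3 $ k * M $ 1 $ j) +
        (Q * p 3) * (M $ 1 $ j * M $ 2 $ k - M $ 1 $ k * M $ 2 $ j)"
      using that unfolding p[symmetric] det_3 sum_3 by (auto simp: algebra_simps)
    then show ?thesis
      by (simp add: cross_def w_def algebra_simps flip: euler_basisD(5)[OF M])
  qed
  have cross: "pconst c * alpha H * \<eta> $ l = - cross j k" if "(l, j, k) \<in> {(1, 2, 3), (2, 3, 1), (3, 1, 2)}" for l j k :: 3
  proof -
    have "Q * (pconst c * alpha H * \<eta> $ l) = Q * (- cross j k)"
      using expand[OF that] by (simp add: p1 c(2) defpoly_remove[OF A H] Q_def mult_ac)
    then show ?thesis
      using mult_left_cancel[OF Q(1)] by blast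
  qed
  have \<alpha>_dvd: "alpha H dvd cross j k" if "(l, j, k) \<in> {(1, 2, 3), (2, 3, 1), (3, 1, 2)}" for l j k :: 3
  proof -
    have "cross j k = - (pconst c * alpha H * \<eta> $ l)"
      by (simp add: cross[OF that])
    then show ?thesis by simp
  qed
  have swap: "cross j k = - cross k j" "cross j j = 0" for j k
    by (simp_all add: cross_def)
  have \<alpha>_dvd_cross: "alpha H dvd cross j k" for j k
    using \<alpha>_dvd[of 1 2 3] \<alpha>_dvd[of 2 3 1] \<alpha>_dvd[of 3 1 2] exhaust_3[of j] exhaust_3[of k]
      swap(1)[of 2 1] swap(1)[of 3 2] swap(1)[of 1 3] swap(2)
    by auto
  have w_log: "w \<in> log_der A"
    unfolding w_def by (intro log_der_diff log_der_scale euler_basisD(1)[OF M])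
  have w_homog: "homog (int a) (w $ l)" for l
    unfolding w_def using euler_basisD(3,4)[OF M, of l] p2 p3
    by (auto intro!: homog_diff intro: homog_mult_eq)
  obtain i where i: "normal H $ i \<noteq> 0"
    using normal_nonzero[OF central_arrangementD(2)[OF A H]] by (auto simp: vec_eq_iff)
  obtain j k where ijk: "i \<noteq> j" "i \<noteq> k" "j \<noteq> k"
    using obtain_other_indices by metis
  have "elim_var (normal H) i (cross j k) = 0"
    using \<alpha>_dvd_cross[of j k] linear_form_dvd_iff[OF i] by (simp add: alpha_altdef)
  then have tangent: "elim_var (normal H) i (w $ j) * pvar k = elim_var (normal H) i (w $ k) * pvar j"
    using ijk by (simp add: cross_def euler_def elim_var_diff elim_var_mult elim_var_pvar)
  have freeI: "free_arrangement (A - {H})"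
    if r: "r \<noteq> 1" and "\<And>l. homog (int (vector [1, a, b] $ r)) (w $ l)"
      and "det (replace_row M r w) = pconst c' * det M" "c' \<noteq> 0" for r c'
  proof -
    have "euler_basis A a b (replace_row M r w)"
      using that by (intro euler_basis_replace[OF M _ w_log, where c = c']) auto
    from free_deletion_of_euler_basis[OF A H this ab(1) _ r i ijk] show ?thesis
      using ab tangent by simp
  qed
  show ?thesis
  proof (cases "c3 = 0")
    case False
    have "det (replace_row M 2 w) = pconst c3 * det M"
      by (simp add: det_3 w_def c3 algebra_simps)
    then show ?thesis
      using False w_homog by (intro freeI[of 2 c3]) auto
  next
    case True
    have "p 2 \<noteq> 0"
    proof
      assume "p 2 = 0"
      then have "w = 0" by (simp add: w_def c3 True)
      then have "\<eta> $ l = 0" if "(l, j, k) \<in> {(1, 2, 3), (2, 3, 1), (3, 1, 2)}" for l j k :: 3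
        using cross[OF that] c(1) prime_elem_alpha[OF central_arrangementD(2)[OF A H]]
        by (auto simp: cross_def prime_elem_def)
      then have "\<eta> = 0"
        unfolding vec_eq_iff forall_3 by auto
      with \<eta>(3) show False ..
    qed
    \<comment> \<open>A nonzero \<open>p 2\<close> cannot have the negative degree
      \<open>a - b\<close>. Hence \<open>w\<close> is a nonzero scalar multiple of the third row and
      may replace it.\<close>
    then have "a = b"
      using homog_neg[OF p2] ab(2) by linarith
    then obtain c2 where c2: "p 2 = pconst c2"
      using p2 homog_0_imp_pconst by auto
    have "det (replace_row M 3 w) = pconst (- c2) * det M"
      by (simp add: det_3 w_def c3 c2 True pconst_uminus algebra_simps)
    then show ?thesis
      using \<open>p 2 \<noteq> 0\<close> c2 w_homog \<open>a = b\<close> by (intro freeI[of 3 "- c2"]) auto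
  qed
qed


section \<open>Logarithmic forms\<close>

text \<open>Multiplying by the defining polynomial turns the wedge condition into divisibility of
  the 2x2 minors of \<open>\<eta>\<close> and the normal, and raises the degree by
  \<open>card B\<close>.\<close>

lemma log_1forms_degE:
  assumes B: "central_arrangement B" and \<omega>: "\<omega> \<in> log_1forms_deg B k"
  obtains \<eta> where "\<omega> = (1 / to_fract (defpoly B)) *s (\<chi> i. to_fract (\<eta> $ i))"
    "\<And>L i j. L \<in> B \<Longrightarrow>
       alpha L dvd \<eta> $ i * pconst (normal L $ j) - \<eta> $ j * pconst (normal L $ i)"
    "\<And>i. homog (int (card B) + k) (\<eta> $ i)"
proof -
  define q where "q = to_fract (defpoly B)"
  have q: "q \<noteq> 0"
    by (simp add: q_def defpoly_nonzero[OF B])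
  obtain \<eta> where \<eta>: "\<omega> = (1 / q) *s (\<chi> i. to_fract (\<eta> $ i))"
    using \<omega> by (auto simp: log_1forms_deg_def log_1forms_def regular_1forms_def q_def)
  have \<eta>_i: "\<omega> $ i = to_fract (\<eta> $ i) / q" for i
    by (simp add: \<eta>)
  show ?thesis
  proof (rule that[OF \<eta>[unfolded q_def]])
    fix L i j assume L: "L \<in> B"
    let ?n = "\<lambda>i. pconst (normal L $ i)"
    obtain \<xi> where \<xi>: "\<xi> \<in> regular_2forms" and wedge_eq:
        "wedge \<omega> (differential (alpha L)) = (\<chi> i j. to_fract (alpha L) / q * \<xi> $ i $ j)"
      using \<omega> L unfolding log_1forms_deg_def log_1forms_def q_def by blast
    obtain t where "\<xi> = (\<chi> i j. to_fract (t $ i $ j))"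
      using \<xi> unfolding regular_2forms_def by blast
    with wedge_eq have "\<omega> $ i * to_fract (?n j) - \<omega> $ j * to_fract (?n i) =
        to_fract (alpha L) / q * to_fract (t $ i $ j)"
      by (simp add: wedge_def differential_def vec_eq_iff alpha_altdef partial_linear_form)
    then have "to_fract (\<eta> $ i * ?n j - \<eta> $ j * ?n i) = to_fract (alpha L * t $ i $ j)"
      using q by (simp add: \<eta>_i field_simps)
    then show "alpha L dvd \<eta> $ i * ?n j - \<eta> $ j * ?n i"
      by (simp only: to_fract_eq_iff) simp
  next
    fix i
    have "fract_homog k (\<omega> $ i)"
      using \<omega> by (simp add: log_1forms_deg_def)
    then obtain f g e where fg: "g \<noteq> 0" "homog (e + k) f" "homog e g" "\<omega> $ i = Fract f g"
      unfolding fract_homog_def by blast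
    have "to_fract (g * \<eta> $ i) = to_fract (f * defpoly B)"
      using fg(1,4) q by (simp add: \<eta>_i Fract_conv_to_fract field_simps q_def)
    then have "homog (e + k + int (card B)) (g * \<eta> $ i)"
      using fg(2) by (simp only: to_fract_eq_iff) (intro homog_mult homog_defpoly)
    from homog_mult_cancel[OF fg(3,1) this] show "homog (int (card B) + k) (\<eta> $ i)"
      by (simp add: algebra_simps)
  qed
qed

lemma log_1forms_degI:
  assumes B: "central_arrangement B" and homog: "\<And>i. homog (int (card B) + k) (\<eta> $ i)"
    and alt: "\<And>L. L \<in> B \<Longrightarrow> \<exists>t. (\<forall>i. t $ i $ i = 0) \<and> (\<forall>i j. t $ i $ j = - t $ j $ i) \<and>
      (\<forall>i j. \<eta> $ i * pconst (normal L $ j) - \<eta> $ j * pconst (normal L $ i) = alpha L * t $ i $ j)"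
  shows "(1 / to_fract (defpoly B)) *s (\<chi> i. to_fract (\<eta> $ i)) \<in> log_1forms_deg B k"
proof -
  define \<omega> where "\<omega> = (1 / to_fract (defpoly B)) *s (\<chi> i. to_fract (\<eta> $ i))"
  have "\<exists>t\<in>regular_2forms. wedge \<omega> (differential (alpha L)) =
        (\<chi> i j. to_fract (alpha L) / to_fract (defpoly B) * t $ i $ j)" if L: "L \<in> B" for L
  proof -
    obtain t where t: "\<forall>i. t $ i $ i = 0" "\<forall>i j. t $ i $ j = - t $ j $ i" and
      eq: "\<And>i j. \<eta> $ i * pconst (normal L $ j) - \<eta> $ j * pconst (normal L $ i) = alpha L * t $ i $ j"
      using alt[OF L] by blast
    have "to_fract (\<eta> $ i) * to_fract (pconst (normal L $ j)) -
        to_fract (\<eta> $ j) * to_fract (pconst (normal L $ i)) =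
        to_fract (alpha L) * to_fract (t $ i $ j)" for i j
      unfolding to_fract_mult[symmetric] to_fract_diff[symmetric] eq ..
    then have "wedge \<omega> (differential (alpha L)) =
        (\<chi> i j. to_fract (alpha L) / to_fract (defpoly B) * (\<chi> i j. to_fract (t $ i $ j)) $ i $ j)"
      by (simp add: wedge_def differential_def vec_eq_iff alpha_altdef partial_linear_form \<omega>_def
          flip: diff_divide_distrib)
    moreover have "(\<chi> i j. to_fract (t $ i $ j)) \<in> regular_2forms"
      using t unfolding regular_2forms_def by blast
    ultimately show ?thesis by blast
  qed
  moreover have "\<exists>\<eta>\<in>regular_1forms. \<omega> = (1 / to_fract (defpoly B)) *s \<eta>"
    by (auto simp: \<omega>_def regular_1forms_def)
  moreover have "fract_homog k (\<omega> $ i)" for i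
    unfolding fract_homog_def
    using defpoly_nonzero[OF B] homog[of i] homog_defpoly[of B]
    by (intro exI[of _ "\<eta> $ i"] exI[of _ "defpoly B"] exI[of _ "int (card B)"])
       (simp add: \<omega>_def Fract_conv_to_fract)
  ultimately show ?thesis
    unfolding \<omega>_def[symmetric] log_1forms_deg_def log_1forms_def by blast
qed

lemma log_1forms_deg_0:
  fixes B :: "('a::field ^ 3) set set"
  shows "central_arrangement B \<Longrightarrow> 0 \<in> log_1forms_deg B k"
proof -
  assume "central_arrangement B"
  then have "(1 / to_fract (defpoly B)) *s (\<chi> i. to_fract ((0 :: 'a S ^ 3) $ i)) \<in> log_1forms_deg B k"
    by (rule log_1forms_degI) (simp_all add: exI[of _ "0 :: 'a S ^ 3 ^ 3"])
  also have "(1 / to_fract (defpoly B)) *s (\<chi> i. to_fract ((0 :: 'a S ^ 3) $ i)) = 0"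
    by (simp add: vec_eq_iff)
  finally show ?thesis .
qed

text \<open>The cross product of the first two rows, divided by \<open>defpoly A\<close>, is up to a
  scalar the form dual to the third row. Its degree is 1 + \<open>a\<close> - \<open>card A\<close>
  = -\<open>b\<close>.\<close>

lemma log_1forms_deg_nonzero:
  fixes A :: "('k::field ^ 3) set set"
  assumes A: "central_arrangement A" and M: "euler_basis A a b M"
    and card: "int (card A) = 1 + int a + int b"
  shows "log_1forms_deg A (- int b) \<noteq> {0}"
proof -
  let ?c = "\<lambda>j k. M $ 1 $ j * M $ 2 $ k - M $ 1 $ k * M $ 2 $ j"
  define \<eta> :: "'k S ^ 3" where "\<eta> = vector [?c 2 3, ?c 3 1, ?c 1 2]"
  have "homog (1 + int a) (?c j k)" for j k
    using euler_basisD(2,3)[OF M] by (intro homog_diff homog_mult)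
  then have "homog (int (card A) + - int b) (\<eta> $ i)" for i
    using exhaust_3[of i] card by (auto simp: \<eta>_def)
  moreover have "\<exists>t. (\<forall>i. t $ i $ i = 0) \<and> (\<forall>i j. t $ i $ j = - t $ j $ i) \<and>
      (\<forall>i j. \<eta> $ i * pconst (normal L $ j) - \<eta> $ j * pconst (normal L $ i) = alpha L * t $ i $ j)"
    if L: "L \<in> A" for L
  proof -
    have "\<exists>g. (\<Sum>i\<in>UNIV. M $ r $ i * pconst (normal L $ i)) = alpha L * g" for r
      using euler_basisD(1)[OF M, of r] L by (auto simp: log_der_altdef dvd_def)
    then obtain g where g: "\<And>r. (\<Sum>i\<in>UNIV. M $ r $ i * pconst (normal L $ i)) = alpha L * g r"
      by metis
    \<comment> \<open>From the vector identity (x \<times> y) \<times> n = (x \<cdot> n) y - (y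
      \<cdot> n) x, divided by \<open>alpha L\<close>; \<open>t\<close> below is the alternating
      matrix of \<open>s\<close>.\<close>
    define s where "s = (\<lambda>l. M $ 2 $ l * g 1 - M $ 1 $ l * g 2)"
    have s: "alpha L * s l = M $ 2 $ l * (\<Sum>i\<in>UNIV. M $ 1 $ i * pconst (normal L $ i)) -
        M $ 1 $ l * (\<Sum>i\<in>UNIV. M $ 2 $ i * pconst (normal L $ i))" for l
      unfolding g s_def by (simp add: algebra_simps)
    define t :: "'k S ^ 3 ^ 3" where "t = vector [vector [0, s 3, - s 2], vector [- s 3, 0, s 1], vector [s 2, - s 1, 0]]"
    show ?thesis
    proof (intro exI[of _ t] conjI)
      show "\<forall>i j. \<eta> $ i * pconst (normal L $ j) - \<eta> $ j * pconst (normal L $ i) = alpha L * t $ i $ j"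
        unfolding forall_3
        by (simp add: t_def \<eta>_def s sum_3 algebra_simps)
    qed (simp_all add: t_def forall_3)
  qed
  ultimately have "(1 / to_fract (defpoly A)) *s (\<chi> i. to_fract (\<eta> $ i)) \<in> log_1forms_deg A (- int b)"
    by (intro log_1forms_degI[OF A])
  moreover have "(1 / to_fract (defpoly A)) *s (\<chi> i. to_fract (\<eta> $ i)) \<noteq> 0"
  proof
    assume "(1 / to_fract (defpoly A)) *s (\<chi> i. to_fract (\<eta> $ i)) = 0"
    then have "\<eta> = 0"
      using defpoly_nonzero[OF A] by (simp add: vec_eq_iff)
    then have "?c 2 3 = 0" "?c 3 1 = 0" "?c 1 2 = 0"
      by (simp_all add: \<eta>_def vec_eq_iff forall_3)
    moreover have "det M = ?c 2 3 * M $ 3 $ 1 + ?c 3 1 * M $ 3 $ 2 + ?c 1 2 * M $ 3 $ 3"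
      by (simp add: det_3 algebra_simps)
    ultimately have "det M = 0"
      by (simp only:)  simp
    then show False
      using euler_basisD(6)[OF M] defpoly_nonzero[OF A] by auto
  qed
  ultimately show ?thesis by blast
qed

section \<open>A lower bound for the number of lines in a restriction\<close>

lemma log_der_degree_0:
  assumes A: "central_arrangement A" and free: "free_with_exponents A d" and d: "\<And>i. 1 \<le> d $ i"
    and \<theta>: "\<theta> \<in> log_der A" "\<And>i. homog 0 (\<theta> $ i)"
  shows "\<theta> = 0"
proof (rule free_with_exponentsE[OF A free])
  fix M c
  assume "\<And>\<theta> k. \<theta> \<in> log_der A \<Longrightarrow> (\<And>i. homog k (\<theta> $ i)) \<Longrightarrow>
       \<exists>f. (\<forall>i. homog (k - int (d $ i)) (f $ i)) \<and> \<theta> = (\<Sum>i\<in>UNIV. f $ i *s M $ i)"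
  from this[OF \<theta>] obtain f where f: "\<And>i. homog (0 - int (d $ i)) (f $ i)"
    and eq: "\<theta> = (\<Sum>i\<in>UNIV. f $ i *s M $ i)"
    by blast
  have "f $ i = 0" for i
    using homog_neg[OF f[of i]] d[of i] by simp
  then show ?thesis by (simp add: eq)
qed

text \<open>If the lines of \<open>\<A>\<^sup>H\<close> coincide, a constant derivation along their common line is
  logarithmic.\<close>

lemma card_restriction_ge_2:
  fixes A :: "('k::field ^ 3) set set"
  assumes A: "central_arrangement A" and H: "H \<in> A" and other: "A - {H} \<noteq> {}"
    and free: "free_with_exponents A d" and d: "\<And>i. 1 \<le> d $ i"
  shows "2 \<le> card (restriction A H)"
proof (rule ccontr)
  assume "\<not> 2 \<le> card (restriction A H)"
  then have le: "card (restriction A H) \<le> Suc 0"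
    by simp
  have fin: "finite (restriction A H)"
    using central_arrangementD(1)[OF A] by (simp add: restriction_def)
  have same: "H \<inter> L = H \<inter> L'" if "L \<in> A - {H}" "L' \<in> A - {H}" for L L'
  proof -
    have "H \<inter> L \<in> restriction A H" "H \<inter> L' \<in> restriction A H"
      unfolding restriction_def by (intro imageI that)+
    then show ?thesis
      using card_le_Suc0_iff_eq[OF fin, THEN iffD1, OF le] by metis
  qed
  obtain L where L: "L \<in> A" "L \<noteq> H"
    using other by blast
  define u w where "u = normal H" and "w = normal L"
  \<comment> \<open>The cross product of the two normals is a direction vector of the line in which
    \<open>H\<close> and \<open>L\<close> meet.\<close>
  define v :: "'k ^ 3" where "v = vector [u $ 2 * w $ 3 - u $ 3 * w $ 2,
    u $ 3 * w $ 1 - u $ 1 * w $ 3, u $ 1 * w $ 2 - u $ 2 * w $ 1]"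
  have "w \<notin> vec.span {u}"
  proof
    assume "w \<in> vec.span {u}"
    then obtain c where "w - c *s u \<in> vec.span {}"
      using vec.span_breakdown_eq[of w u "{}"] by auto
    then have "normal L = c *s normal H"
      by (simp add: u_def w_def)
    then show False
      using hyperplane_eqI central_arrangementD(2)[OF A] H L by blast
  qed
  moreover have "u \<noteq> 0"
    unfolding u_def by (rule normal_nonzero[OF central_arrangementD(2)[OF A H]])
  ultimately have "v \<noteq> 0"
    unfolding v_def by (intro cross_nonzero)
  have mem: "x \<in> K \<longleftrightarrow> (\<Sum>i\<in>UNIV. normal K $ i * x $ i) = 0" if "K \<in> A" for K x
    using kernel_normal[OF central_arrangementD(2)[OF A that]] by blast
  have "v \<in> H \<inter> L"
    using mem[OF H] mem[OF L(1)] unfolding u_def[symmetric] w_def[symmetric]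
    by (simp add: v_def sum_3 algebra_simps)
  then have v_mem: "v \<in> K" if "K \<in> A" for K
    using same[of L K] L that by (cases "K = H") auto
  \<comment> \<open>The vector \<open>v\<close> lies in every hyperplane of \<open>A\<close>, so the
    constant derivation along \<open>v\<close> kills every \<open>alpha K\<close>; its degree 0 is
    excluded by the positive exponents.\<close>
  define \<theta> :: "'k S ^ 3" where "\<theta> = (\<chi> i. pconst (v $ i))"
  have "(\<Sum>i\<in>UNIV. \<theta> $ i * pconst (normal K $ i)) = pconst (\<Sum>i\<in>UNIV. normal K $ i * v $ i)" for K
    by (simp add: \<theta>_def sum_3 pconst_add pconst_mult mult.commute)
  then have "\<theta> \<in> log_der A"
    using v_mem mem by (simp add: log_der_altdef)
  then have "\<theta> = 0"
    by (intro log_der_degree_0[OF A free d]) (simp_all add: \<theta>_def)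
  then show False
    using \<open>v \<noteq> 0\<close> by (simp add: \<theta>_def vec_eq_iff)
qed

theorem theorem4p2:
  fixes A :: "('k::field ^ 3) set set" and a b :: nat
  assumes "central_arrangement A"
    and "free_with_exponents A (vector [1, a, b])"
    and "\<not> reducible A"
    and "1 \<le> a" and "a \<le> b"
    and "\<forall>H\<in>A. \<not> free_arrangement (A - {H})"
  shows "critical (int b) A \<and>
    (\<forall>H\<in>A. int (card A) - int (card (restriction A H)) \<noteq> int b)"
proof -
  note A = assms(1) and free = assms(2) and a = assms(4) and ab = assms(5)
  obtain M where M: "euler_basis A a b M"
    using euler_basis_exists[OF A free a] a ab by auto
  have card: "int (card A) = 1 + int a + int b"
    by (rule free_with_exponentsE[OF A free]) (simp add: sum_3)
  have card_restriction: "card (restriction A H) \<noteq> a + 1" if "H \<in> A" for H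
    using free_deletion_if_card_restriction[OF A that M a ab] assms(6) that by blast
  have "log_1forms_deg (A - {H}) (- int b) = {0}" if H: "H \<in> A" for H
  proof (rule ccontr)
    have B: "central_arrangement (A - {H})"
      by (rule central_arrangementD(3)[OF A])
    assume "log_1forms_deg (A - {H}) (- int b) \<noteq> {0}"
    then obtain \<omega> where \<omega>: "\<omega> \<in> log_1forms_deg (A - {H}) (- int b)" "\<omega> \<noteq> 0"
      using log_1forms_deg_0[OF B] by blast
    obtain \<eta> where \<eta>: "\<omega> = (1 / to_fract (defpoly (A - {H}))) *s (\<chi> i. to_fract (\<eta> $ i))"
      "\<And>L i j. L \<in> A - {H} \<Longrightarrow>
         alpha L dvd \<eta> $ i * pconst (normal L $ j) - \<eta> $ j * pconst (normal L $ i)"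
      "\<And>i. homog (int (card (A - {H})) + - int b) (\<eta> $ i)"
      using log_1forms_degE[OF B \<omega>(1)] by metis
    have "\<eta> \<noteq> 0"
      using \<eta>(1) \<omega>(2) by (auto simp: vec_eq_iff)
    show False
    proof (cases "2 \<le> b")
      case True
      then show False
        using free_deletion_if_log_form[OF A H M a ab True \<eta>(2) _ \<open>\<eta> \<noteq> 0\<close>] \<eta>(3) assms(6) H
        by simp
    next
      case False
      then have "a = 1" "b = 1"
        using a ab by auto
      \<comment> \<open>With only two other hyperplanes, the restriction has at most two lines, and
        by freeness at least two. This is the excluded value \<open>a + 1\<close>.\<close>
      then have card_B: "card (A - {H}) = 2"
        using card H central_arrangementD(1)[OF A] by simp
      have "A - {H} \<noteq> {}"
        using card_B by (metis card.empty zero_neq_numeral)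
      moreover have "1 \<le> (vector [1, a, b] :: nat ^ 3) $ i" for i
        using exhaust_3[of i] \<open>a = 1\<close> \<open>b = 1\<close> by auto
      ultimately have "2 \<le> card (restriction A H)"
        by (intro card_restriction_ge_2[OF A H _ free])
      moreover have "card (restriction A H) \<le> card (A - {H})"
        unfolding restriction_def by (intro card_image_le) (simp add: central_arrangementD(1)[OF A])
      ultimately show False
        using card_restriction[OF H] card_B \<open>a = 1\<close> by simp
    qed
  qed
  \<comment> \<open>As \<open>card A\<close> is 1 + \<open>a\<close> + \<open>b\<close>, equality
    would mean that the restriction has exactly \<open>a + 1\<close> lines.\<close>
  moreover have "int (card A) - int (card (restriction A H)) \<noteq> int b" if "H \<in> A" for H
    using card card_restriction[OF that] by auto
  ultimately show ?thesis
    using log_1forms_deg_nonzero[OF A M card] by (auto simp: critical_def)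
qed

end
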